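(* Let $L$ be strictly convex concave and assume that every initialization $(\theta(0),\phi(0))\in\mathbb{R}^N\times\mathbb{R}^M$ is safe for at least one element of $\mathrm{Solution}(L)$. Then the set $$\{(\theta^*,\phi^* )\in\mathbb{R}^N\times\mathbb{R}^M:\ (F(\theta^* ),G(\phi^* ))\in\mathrm{Solution}(L)\}$$ is globally asymptotically stable for the continuous gradient descent ascent dynamics.
   Context: Setting: $n,m,n_1,\dots,n_n,m_1,\dots,m_m$ are positive integers, $N=\sum_i n_i$, $M=\sum_j m_j$; $f_i:\mathbb{R}^{n_i}\to\mathbb{R}$, $g_j:\mathbb{R}^{m_j}\to\mathbb{R}$ and $L:\mathbb{R}^n\times\mathbb{R}^m\to\mathbb{R}$, $(x,y)\mapsto L(x,y)$, are $C^2$. Write $\theta=(\theta_1,\dots,\theta_n)\in\mathbb{R}^N$, $\theta_i\in\mathbb{R}^{n_i}$, $\phi=(\phi_1,\dots,\phi_m)\in\mathbb{R}^M$, $\phi_j\in\mathbb{R}^{m_j}$, and $F(\theta)=(f_1(\theta_1),\dots,f_n(\theta_n))$, $G(\phi)=(g_1(\phi_1),\dots,g_m(\phi_m))$. Convex concave: $L(\cdot,y)$ is convex for every $y\in\mathbb{R}^m$ and $L(x,\cdot)$ is concave for every $x\in\mathbb{R}^n$. Strictly convex concave: $L$ is convex concave and for every $(x,y)\in\mathbb{R}^n\times\mathbb{R}^m$ either $L(\cdot,y)$ is strictly convex or $L(x,\cdot)$ is strictly concave. $\mathrm{Solution}(L)$ is the set of equilibria of $L$: pairs $(p,q)$ with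 $L(p,y)\le L(p,q)\le L(x,q)$ for all $x\in\mathbb{R}^n,y\in\mathbb{R}^m$ (for convex concave $L$, equivalently the stationary points of $L$). Gradient descent ascent (GDA) dynamics: $\dot\theta_i=-\nabla f_i(\theta_i)\,\frac{\partial L}{\partial x_i}(F(\theta),G(\phi))$, $\dot\phi_j=\nabla g_j(\phi_j)\,\frac{\partial L}{\partial y_j}(F(\theta),G(\phi))$. Gradient ascent image: for $k:\mathbb{R}^d\to\mathbb{R}$ of class $C^2$ and $x_0\in\mathbb{R}^d$, let $x:\mathbb{R}\to\mathbb{R}^d$ be the solution of $\dot x=\nabla k(x)$, $x(0)=x_0$; $\operatorname{Im}_k(x_0)$ is the image of $k\circ x:\mathbb{R}\to\mathbb{R}$. The gradient ascent trajectories of the $f_i,g_j$ are assumed to be defined for all times $t\in\mathbb{R}$. Safe: $(\theta(0),\phi(0))$ is safe for $(p,q)\in\mathrm{Solution}(L)$ if no $\theta_i(0)$ is a stationary point of $f_i$, no $\phi_j(0)$ is a stationary point of $g_j$, and $p_i\in\operatorname{Im}_{f_i}(\theta_i(0))$, $q_j\in\operatorname{Im}_{g_j}(\phi_j(0))$ for all $i,j$. Globally asymptotically stable (the paper's definition): a set $S$ is globally asymptotically stable for an autonomous system if for every initialization $w(0)$ in the whole space the trajectory $w(t)$ approaches $S$ as $t\to+\infty$, i.e. $\inf_{s\in S}\|w(t)-s\|\to0$. *)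

theory Defs
  imports "HOL-Analysis.Analysis"
begin

definition C2 :: "('a::euclidean_space \<Rightarrow> real) \<Rightarrow> bool" where
  "C2 f \<longleftrightarrow> (\<exists>(f' :: 'a \<Rightarrow> 'a \<Rightarrow>\<^sub>L real) (f'' :: 'a \<Rightarrow> 'a \<Rightarrow>\<^sub>L 'a \<Rightarrow>\<^sub>L real).
     (\<forall>x. (f has_derivative blinfun_apply (f' x)) (at x)) \<and>
     (\<forall>x. (f' has_derivative blinfun_apply (f'' x)) (at x)) \<and>
     continuous_on UNIV f'')"

definition grad :: "('a::real_inner \<Rightarrow> real) \<Rightarrow> 'a \<Rightarrow> 'a" where
  "grad f x = (THE D. GDERIV f x :> D)"

definition partial_x :: "((real^'n) \<times> (real^'m) \<Rightarrow> real) \<Rightarrow> 'n \<Rightarrow> real^'n \<Rightarrow> real^'m \<Rightarrow> real" where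
  "partial_x L i x y = deriv (\<lambda>t. L (x + t *\<^sub>R axis i 1, y)) 0"

definition partial_y :: "((real^'n) \<times> (real^'m) \<Rightarrow> real) \<Rightarrow> 'm \<Rightarrow> real^'n \<Rightarrow> real^'m \<Rightarrow> real" where
  "partial_y L j x y = deriv (\<lambda>t. L (x, y + t *\<^sub>R axis j 1)) 0"

definition strictly_convex :: "('a::real_vector \<Rightarrow> real) \<Rightarrow> bool" where
  "strictly_convex f \<longleftrightarrow>
     (\<forall>x y t. x \<noteq> y \<longrightarrow> 0 < t \<longrightarrow> t < 1 \<longrightarrow>
        f ((1 - t) *\<^sub>R x + t *\<^sub>R y) < (1 - t) * f x + t * f y)"

definition strictly_concave :: "('a::real_vector \<Rightarrow> real) \<Rightarrow> bool" where
  "strictly_concave f \<longleftrightarrow> strictly_convex (\<lambda>x. - f x)"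

definition convex_concave :: "('a::real_vector \<times> 'b::real_vector \<Rightarrow> real) \<Rightarrow> bool" where
  "convex_concave L \<longleftrightarrow>
     (\<forall>y. convex_on UNIV (\<lambda>x. L (x, y))) \<and> (\<forall>x. concave_on UNIV (\<lambda>y. L (x, y)))"

definition strictly_convex_concave :: "('a::real_vector \<times> 'b::real_vector \<Rightarrow> real) \<Rightarrow> bool" where
  "strictly_convex_concave L \<longleftrightarrow> convex_concave L \<and>
     (\<forall>x y. strictly_convex (\<lambda>x'. L (x', y)) \<or> strictly_concave (\<lambda>y'. L (x, y')))"

definition Solution :: "('a \<times> 'b \<Rightarrow> real) \<Rightarrow> ('a \<times> 'b) set" where
  "Solution L = {(p, q). \<forall>x y. L (p, y) \<le> L (p, q) \<and> L (p, q) \<le> L (x, q)}"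

definition solves_on :: "real set \<Rightarrow> ('a::real_normed_vector \<Rightarrow> 'a) \<Rightarrow> (real \<Rightarrow> 'a) \<Rightarrow> bool" where
  "solves_on T V w \<longleftrightarrow> (\<forall>t\<in>T. (w has_vector_derivative V (w t)) (at t within T))"

definition gradient_ascent :: "('a::real_inner \<Rightarrow> real) \<Rightarrow> 'a \<Rightarrow> (real \<Rightarrow> 'a) \<Rightarrow> bool" where
  "gradient_ascent k x0 x \<longleftrightarrow> solves_on UNIV (grad k) x \<and> x 0 = x0"

definition complete_gradient_ascent :: "('a::real_inner \<Rightarrow> real) \<Rightarrow> bool" where
  "complete_gradient_ascent k \<longleftrightarrow> (\<forall>x0. \<exists>x. gradient_ascent k x0 x)"

definition gradient_ascent_image :: "('a::real_inner \<Rightarrow> real) \<Rightarrow> 'a \<Rightarrow> real set" where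
  "gradient_ascent_image k x0 = range (k \<circ> (THE x. gradient_ascent k x0 x))"

text \<open>
  The blocks \<open>\<theta>\<^sub>i\<close> of \<open>\<theta> \<in> \<real>\<^sup>N\<close> are encoded by a map \<open>b\<close> sending each of the \<open>N\<close> coordinates to
  the index of the block containing it, so that block \<open>i\<close> has dimension \<open>card (b -` {i})\<close>.
  All these dimensions are positive iff \<open>b\<close> is surjective.  A function \<open>f\<^sub>i\<close> of \<open>\<theta>\<^sub>i\<close> is encoded
  as a function of \<open>\<theta>\<close> depending only on block \<open>i\<close>.  Its gradient at \<open>\<theta>\<close> is then
  \<open>\<nabla>f\<^sub>i(\<theta>\<^sub>i)\<close> on block \<open>i\<close> and zero on the other blocks; accordingly, its gradient ascent
  trajectories are those of \<open>f\<^sub>i\<close> on block \<open>i\<close> and constant on the other blocks.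
\<close>

definition depends_only_on_block :: "('k::finite \<Rightarrow> 'n) \<Rightarrow> 'n \<Rightarrow> (real^'k \<Rightarrow> real) \<Rightarrow> bool" where
  "depends_only_on_block b i h \<longleftrightarrow>
     (\<forall>\<theta> \<theta>'. (\<forall>k. b k = i \<longrightarrow> \<theta> $ k = \<theta>' $ k) \<longrightarrow> h \<theta> = h \<theta>')"

definition tuple_map :: "('n::finite \<Rightarrow> 'a \<Rightarrow> real) \<Rightarrow> 'a \<Rightarrow> real^'n" where
  "tuple_map f \<theta> = (\<chi> i. f i \<theta>)"

definition gda_field ::
  "('k::finite \<Rightarrow> 'n::finite) \<Rightarrow> ('l::finite \<Rightarrow> 'm::finite) \<Rightarrow>
   ('n \<Rightarrow> real^'k \<Rightarrow> real) \<Rightarrow> ('m \<Rightarrow> real^'l \<Rightarrow> real) \<Rightarrow>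
   ((real^'n) \<times> (real^'m) \<Rightarrow> real) \<Rightarrow> (real^'k) \<times> (real^'l) \<Rightarrow> (real^'k) \<times> (real^'l)" where
  "gda_field b c f g L = (\<lambda>(\<theta>, \<phi>).
     (\<chi> k. - (grad (f (b k)) \<theta> $ k) * partial_x L (b k) (tuple_map f \<theta>) (tuple_map g \<phi>),
      \<chi> l. (grad (g (c l)) \<phi> $ l) * partial_y L (c l) (tuple_map f \<theta>) (tuple_map g \<phi>)))"

definition safe ::
  "('n::finite \<Rightarrow> real^'k \<Rightarrow> real) \<Rightarrow> ('m::finite \<Rightarrow> real^'l \<Rightarrow> real) \<Rightarrow>
   real^'k \<Rightarrow> real^'l \<Rightarrow> real^'n \<Rightarrow> real^'m \<Rightarrow> bool" where
  "safe f g \<theta> \<phi> p q \<longleftrightarrow>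
     (\<forall>i. grad (f i) \<theta> \<noteq> 0) \<and> (\<forall>j. grad (g j) \<phi> \<noteq> 0) \<and>
     (\<forall>i. p $ i \<in> gradient_ascent_image (f i) \<theta>) \<and>
     (\<forall>j. q $ j \<in> gradient_ascent_image (g j) \<phi>)"

text \<open>
  The condition \<open>S \<noteq> {}\<close> is needed because \<open>infdist x {} = 0\<close> in the library, whereas the infimum
  of the empty set is \<open>\<infinity>\<close> here.
\<close>

definition approaches :: "(real \<Rightarrow> 'a::metric_space) \<Rightarrow> 'a set \<Rightarrow> bool" where
  "approaches w S \<longleftrightarrow> S \<noteq> {} \<and> ((\<lambda>t. infdist (w t) S) \<longlongrightarrow> 0) at_top"

text \<open>
  Existence of a trajectory on \<open>[0, \<infinity>)\<close> from every initial point is part of the definition, so that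
  it cannot hold vacuously.
\<close>

definition globally_asymptotically_stable ::
  "('a::real_normed_vector \<Rightarrow> 'a) \<Rightarrow> 'a set \<Rightarrow> bool" where
  "globally_asymptotically_stable V S \<longleftrightarrow>
     (\<forall>w0. (\<exists>w. solves_on {0..} V w \<and> w 0 = w0) \<and>
           (\<forall>w. solves_on {0..} V w \<and> w 0 = w0 \<longrightarrow> approaches w S))"

end

theory Submission
  imports Defs
begin

text \<open>
Under gradient descent ascent, the block \<open>\<theta>\<^sub>i\<close> always moves along \<open>\<nabla>f\<^sub>i\<close>.  So it never
leaves the gradient ascent curve \<open>X\<^sub>i\<close> of \<open>f\<^sub>i\<close> through its initial value, and only the time
\<open>s\<^sub>i\<close> reached on that curve is unknown; likewise for the blocks \<open>\<phi>\<^sub>j\<close>, with curves \<open>Y\<^sub>j\<close> and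
times \<open>r\<^sub>j\<close>.  Put \<open>h\<^sub>i = f\<^sub>i \<circ> X\<^sub>i\<close> and \<open>k\<^sub>j = g\<^sub>j \<circ> Y\<^sub>j\<close>.  The times solve the reduced system
\<open>s' = - \<nabla>\<^sub>x L (h s, k r)\<close>, \<open>r' = \<nabla>\<^sub>y L (h s, k r)\<close>, and a solution of it gives one of the original
system (\<open>block_reparametrization\<close>).

Safety for \<open>(p, q)\<close> makes every \<open>h\<^sub>i\<close> strictly increasing, because a gradient ascent curve that
starts at a nonstationary point meets no stationary point, and it provides a time at which \<open>h\<^sub>i\<close>
takes the value \<open>p\<^sub>i\<close>; similarly for \<open>k\<^sub>j\<close> and \<open>q\<^sub>j\<close>.  Hence the integrals of \<open>h\<^sub>i - p\<^sub>i\<close> and of \<open>k\<^sub>j - q\<^sub>j\<close> are bounded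
below and have bounded sublevel sets, and their sum is a Lyapunov function: the tangent inequalities
for \<open>L\<close> bound its derivative along the reduced system by \<open>L (p, k r) - L (h s, q) \<le> 0\<close>.  So the
times stay bounded.  This gives a solution on \<open>[0, \<infinity>)\<close> (\<open>solution_exists_of_lyapunov\<close>), and
it makes limit points available.

At a limit point \<open>(s, r)\<close> the derivative of the Lyapunov function vanishes, so that
\<open>L (p, y) = L (p, q) = L (x, q)\<close> with \<open>x = h s\<close> and \<open>y = k r\<close>.  Suppose that \<open>L (\<cdot>, q)\<close> is strictly
convex; the other case is symmetric.  Then \<open>x = p\<close> at all limit points, so the component \<open>s\<close>
converges and its velocity \<open>- \<nabla>\<^sub>x L (p, y)\<close> vanishes at them.  Thus \<open>p\<close> minimizes \<open>L (\<cdot>, y)\<close>, while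
\<open>y\<close> maximizes \<open>L (p, \<cdot>)\<close> because it attains the value \<open>L (p, q)\<close>: the limit point is an equilibrium
(\<open>reduced_field_converges\<close>).

Finally, the gradient descent ascent field is Lipschitz on bounded sets, so no initial point has any
trajectory other than the one constructed (\<open>solution_unique\<close>).
\<close>

section \<open>Maps that are Lipschitz on bounded sets\<close>

text \<open>
This form of local Lipschitz continuity is closed under composition and products without any
compactness argument, and it holds for all first derivatives of \<open>C\<^sup>2\<close> functions.
\<close>

definition boundedly_lipschitz :: "('a::metric_space \<Rightarrow> 'b::metric_space) \<Rightarrow> bool" where
  "boundedly_lipschitz f \<longleftrightarrow> (\<forall>S. bounded S \<longrightarrow> (\<exists>C. C-lipschitz_on S f))"

lemma boundedly_lipschitzE:
  assumes "boundedly_lipschitz f" "bounded S"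
  obtains C where "C-lipschitz_on S f" "C \<ge> 0"
  using assms lipschitz_on_nonneg unfolding boundedly_lipschitz_def by blast

lemma boundedly_lipschitz_bounded_image:
  assumes "boundedly_lipschitz f" "bounded S"
  shows "bounded (f ` S)"
proof -
  obtain C where C: "C-lipschitz_on S f" "C \<ge> 0"
    using boundedly_lipschitzE[OF assms] by blast
  obtain x0 e where "\<forall>y\<in>S. dist x0 y \<le> e" "S \<noteq> {} \<longrightarrow> x0 \<in> S"
    using assms(2) by (metis bounded_any_center ex_in_conv)
  then have "dist (f x0) (f y) \<le> C * e" if "y \<in> S" for y
    using lipschitz_onD[OF C(1), of x0 y] C(2) that
    by (smt (verit, best) empty_iff mult_left_mono)
  then show ?thesis
    unfolding bounded_def by blast
qed

lemma boundedly_lipschitz_imp_continuous: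
  assumes "boundedly_lipschitz f"
  shows "continuous_on S f"
proof -
  have "continuous (at x) f" for x
  proof -
    obtain C where "C-lipschitz_on (ball x 1) f"
      using boundedly_lipschitzE[OF assms, of "ball x 1"] by auto
    then show ?thesis
      using lipschitz_on_continuous_on continuous_on_interior
      by (metis centre_in_ball interior_ball zero_less_one)
  qed
  then show ?thesis
    by (simp add: continuous_at_imp_continuous_on)
qed

lemma boundedly_lipschitz_compose:
  fixes f :: "'a::metric_space \<Rightarrow> 'b::metric_space" and g :: "'b \<Rightarrow> 'c::metric_space"
  assumes "boundedly_lipschitz g" "boundedly_lipschitz f"
  shows "boundedly_lipschitz (\<lambda>x. g (f x))"
  unfolding boundedly_lipschitz_def
proof (intro allI impI)
  fix S :: "'a set" assume S: "bounded S"
  obtain C where C: "C-lipschitz_on S f"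
    using boundedly_lipschitzE[OF assms(2) S] .
  obtain D where D: "D-lipschitz_on (f ` S) g"
    using boundedly_lipschitzE[OF assms(1) boundedly_lipschitz_bounded_image[OF assms(2) S]] .
  show "\<exists>C. C-lipschitz_on S (\<lambda>x. g (f x))"
    using lipschitz_on_compose2[OF C D] by blast
qed

lemma boundedly_lipschitz_Pair:
  assumes "boundedly_lipschitz f" "boundedly_lipschitz g"
  shows "boundedly_lipschitz (\<lambda>x. (f x, g x))"
  using assms unfolding boundedly_lipschitz_def by (blast intro: lipschitz_on_Pair)

lemma boundedly_lipschitz_minus:
  fixes f :: "'a::metric_space \<Rightarrow> 'b::real_normed_vector"
  assumes "boundedly_lipschitz f"
  shows "boundedly_lipschitz (\<lambda>x. - f x)"
  using assms unfolding boundedly_lipschitz_def by simp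

text \<open>
A product is Lipschitz where its factors are Lipschitz and bounded; on a bounded set the second
follows from the first.
\<close>

lemma boundedly_lipschitz_scaleR:
  fixes f :: "'a::metric_space \<Rightarrow> 'b::real_normed_vector" and a :: "'a \<Rightarrow> real"
  assumes "boundedly_lipschitz a" "boundedly_lipschitz f"
  shows "boundedly_lipschitz (\<lambda>x. a x *\<^sub>R f x)"
  unfolding boundedly_lipschitz_def
proof (intro allI impI)
  fix S :: "'a set" assume S: "bounded S"
  obtain C D where C: "C-lipschitz_on S a" "C \<ge> 0" and D: "D-lipschitz_on S f" "D \<ge> 0"
    using boundedly_lipschitzE[OF assms(1) S] boundedly_lipschitzE[OF assms(2) S] by metis
  obtain A B where A: "\<And>x. x \<in> S \<Longrightarrow> norm (a x) \<le> A" "A \<ge> 0" and B: "\<And>x. x \<in> S \<Longrightarrow> norm (f x) \<le> B" "B \<ge> 0"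
    using boundedly_lipschitz_bounded_image[OF assms(1) S] boundedly_lipschitz_bounded_image[OF assms(2) S]
    unfolding bounded_pos by (metis imageI less_imp_le)
  have "(A * D + C * B)-lipschitz_on S (\<lambda>x. a x *\<^sub>R f x)"
  proof (rule lipschitz_onI)
    fix x y assume xy: "x \<in> S" "y \<in> S"
    have "a x *\<^sub>R f x - a y *\<^sub>R f y = a x *\<^sub>R (f x - f y) + (a x - a y) *\<^sub>R f y"
      by (simp add: algebra_simps)
    then have "norm (a x *\<^sub>R f x - a y *\<^sub>R f y) \<le> norm (a x) * norm (f x - f y) + norm (a x - a y) * norm (f y)"
      by (metis norm_scaleR norm_triangle_ineq real_norm_def)
    also have "\<dots> \<le> A * (D * dist x y) + (C * dist x y) * B"
      using lipschitz_onD[OF C(1) xy] lipschitz_onD[OF D(1) xy] A(1)[OF xy(1)] B(1)[OF xy(2)] A(2) B(2) C(2)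
      by (intro add_mono mult_mono) (auto simp: dist_norm)
    finally show "dist (a x *\<^sub>R f x) (a y *\<^sub>R f y) \<le> (A * D + C * B) * dist x y"
      by (simp add: dist_norm algebra_simps)
  qed (use A B C D in simp)
  then show "\<exists>C. C-lipschitz_on S (\<lambda>x. a x *\<^sub>R f x)" by blast
qed

lemma boundedly_lipschitz_bounded_linear:
  assumes "bounded_linear f"
  shows "boundedly_lipschitz f"
  unfolding boundedly_lipschitz_def
proof (intro allI impI)
  fix S
  obtain B where "B-lipschitz_on S f"
    by (rule bounded_linear.lipschitz_boundE[OF assms])
  then show "\<exists>C. C-lipschitz_on S f" ..
qed

lemma boundedly_lipschitz_linear_compose:
  assumes "bounded_linear A" "boundedly_lipschitz f"
  shows "boundedly_lipschitz (\<lambda>x. A (f x))"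
  using boundedly_lipschitz_compose[OF boundedly_lipschitz_bounded_linear[OF assms(1)] assms(2)] .

lemma lipschitz_on_sum:
  fixes f :: "'i \<Rightarrow> 'a::metric_space \<Rightarrow> 'b::real_normed_vector"
  assumes "finite I" "\<And>i. i \<in> I \<Longrightarrow> (C i)-lipschitz_on S (f i)"
  shows "(\<Sum>i\<in>I. C i)-lipschitz_on S (\<lambda>x. \<Sum>i\<in>I. f i x)"
  using assms by (induction rule: finite_induct) (auto intro: lipschitz_on_add lipschitz_on_constant)

lemma boundedly_lipschitz_sum:
  fixes f :: "'i \<Rightarrow> 'a::metric_space \<Rightarrow> 'b::real_normed_vector"
  assumes "finite I" "\<And>i. i \<in> I \<Longrightarrow> boundedly_lipschitz (f i)"
  shows "boundedly_lipschitz (\<lambda>x. \<Sum>i\<in>I. f i x)"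
  unfolding boundedly_lipschitz_def
proof (intro allI impI)
  fix S :: "'a set" assume "bounded S"
  then have "\<forall>i\<in>I. \<exists>C. C-lipschitz_on S (f i)"
    using assms(2) boundedly_lipschitz_def by blast
  then obtain C where "\<And>i. i \<in> I \<Longrightarrow> (C i)-lipschitz_on S (f i)"
    by metis
  then show "\<exists>C. C-lipschitz_on S (\<lambda>x. \<Sum>i\<in>I. f i x)"
    using lipschitz_on_sum[OF assms(1)] by blast
qed

lemma vec_lambda_eq_sum_axis:
  fixes u :: "'n::finite \<Rightarrow> real"
  shows "(\<chi> i. u i) = (\<Sum>i\<in>UNIV. u i *\<^sub>R axis i 1)"
  using basis_expansion[of "\<chi> i. u i"] by (simp add: scalar_mult_eq_scaleR)

lemma boundedly_lipschitz_vec_lambda: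
  fixes u :: "'n::finite \<Rightarrow> 'a::metric_space \<Rightarrow> real"
  assumes "\<And>i. boundedly_lipschitz (u i)"
  shows "boundedly_lipschitz (\<lambda>x. \<chi> i. u i x)"
  unfolding vec_lambda_eq_sum_axis
  by (intro boundedly_lipschitz_sum finite boundedly_lipschitz_linear_compose[OF bounded_linear_scaleR_left] assms)

lemma boundedly_lipschitz_mult_vec_lambda:
  fixes u v :: "'k::finite \<Rightarrow> 'a::metric_space \<Rightarrow> real"
  assumes "\<And>k. boundedly_lipschitz (u k)" "\<And>k. boundedly_lipschitz (v k)"
  shows "boundedly_lipschitz (\<lambda>x. \<chi> k. u k x * v k x)"
  using boundedly_lipschitz_scaleR[OF assms]
  by (intro boundedly_lipschitz_vec_lambda) simp

text \<open>
On a closed ball the continuous norm of the derivative is bounded by compactness, and the mean value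
theorem applies because balls are convex.
\<close>

lemma boundedly_lipschitz_of_derivative:
  fixes f :: "'a::euclidean_space \<Rightarrow> 'b::real_normed_vector"
  assumes f: "\<And>x. (f has_derivative f' x) (at x)"
    and cont: "continuous_on UNIV (\<lambda>x. onorm (f' x))"
  shows "boundedly_lipschitz f"
  unfolding boundedly_lipschitz_def
proof (intro allI impI)
  fix S :: "'a set" assume "bounded S"
  then obtain R where R: "S \<subseteq> cball 0 R"
    by (meson ball_subset_cball bounded_subset_ballD order_trans)
  have "bounded ((\<lambda>x. onorm (f' x)) ` cball 0 R)"
    by (intro compact_imp_bounded compact_continuous_image continuous_on_subset[OF cont]) auto
  then obtain C where C: "C > 0" "\<And>x. x \<in> cball 0 R \<Longrightarrow> onorm (f' x) \<le> C"
    unfolding bounded_pos by (metis abs_le_D1 image_eqI real_norm_def)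
  have "C-lipschitz_on (cball 0 R) f"
    by (rule bounded_derivative_imp_lipschitz[of _ _ f'])
      (use C f in \<open>auto intro: has_derivative_at_withinI\<close>)
  then show "\<exists>C. C-lipschitz_on S f"
    using R lipschitz_on_subset by blast
qed

lemma boundedly_lipschitz_of_blinfun_derivative:
  fixes f :: "'a::euclidean_space \<Rightarrow> 'b::real_normed_vector"
  assumes "\<And>x. (f has_derivative blinfun_apply (f' x)) (at x)" "continuous_on UNIV f'"
  shows "boundedly_lipschitz f"
  using assms(1)
  by (rule boundedly_lipschitz_of_derivative)
    (auto simp flip: norm_blinfun.rep_eq intro!: continuous_intros assms(2))

lemma boundedly_lipschitz_of_vector_derivative:
  fixes f :: "real \<Rightarrow> 'b::real_normed_vector"
  assumes "\<And>x. (f has_vector_derivative f' x) (at x)" "continuous_on UNIV f'"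
  shows "boundedly_lipschitz f"
proof (rule boundedly_lipschitz_of_derivative)
  show "(f has_derivative (\<lambda>h. h *\<^sub>R f' x)) (at x)" for x
    using assms(1) by (simp add: has_vector_derivative_def)
  have "onorm (\<lambda>h. h *\<^sub>R v) = norm v" for v :: 'b
    using onorm_scaleR_left[of "\<lambda>h::real. h" v] onorm_id[where 'a=real]
    by (auto simp: bounded_linear_ident id_def)
  then show "continuous_on UNIV (\<lambda>x. onorm (\<lambda>h. h *\<^sub>R f' x))"
    by (auto intro: continuous_intros assms(2))
qed

section \<open>Uniqueness and existence of trajectories\<close>

lemma solves_on_imp_continuous_on:
  assumes "solves_on T V w"
  shows "continuous_on T w"
  using assms unfolding solves_on_def continuous_on_eq_continuous_within
  by (blast intro: has_vector_derivative_continuous)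

lemma solves_on_subset:
  assumes "solves_on T V w" "S \<subseteq> T"
  shows "solves_on S V w"
  using assms unfolding solves_on_def
  by (blast intro: has_vector_derivative_within_subset)

text \<open>
Gronwall's argument for \<open>D = \<parallel>x - y\<parallel>\<^sup>2\<close>: if \<open>K\<close> is a Lipschitz constant of \<open>V\<close> on the compact
set of values of \<open>x\<close> and \<open>y\<close> between the times \<open>a\<close> and \<open>t\<close>, then \<open>\<bar>D'\<bar> \<le> 2 K D\<close>.  So
\<open>D \<tau> exp (- 2 K \<tau>)\<close> is nonincreasing and \<open>D \<tau> exp (2 K \<tau>)\<close> is nondecreasing in \<open>\<tau>\<close>; the first
settles times \<open>t\<close> after \<open>a\<close>, the second times before \<open>a\<close>.
\<close>

lemma solution_unique:
  fixes x y :: "real \<Rightarrow> 'a::euclidean_space"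
  assumes V: "boundedly_lipschitz V"
    and x: "solves_on T V x" and y: "solves_on T V y"
    and T: "is_interval T" "a \<in> T" "t \<in> T" and eq: "x a = y a"
  shows "x t = y t"
proof -
  define S where "S = {min a t..max a t}"
  have S: "S \<subseteq> T" 
  proof
    fix \<tau> assume "\<tau> \<in> S"
    then have "a \<le> \<tau> \<and> \<tau> \<le> t \<or> t \<le> \<tau> \<and> \<tau> \<le> a"
      by (auto simp: S_def)
    then show "\<tau> \<in> T"
      using T unfolding is_interval_1 by blast
  qed
  have xS: "solves_on S V x" and yS: "solves_on S V y"
    using x y S solves_on_subset by blast+
  note cont = xS[THEN solves_on_imp_continuous_on] yS[THEN solves_on_imp_continuous_on]
  have "compact S" by (simp add: S_def)
  then have "bounded (x ` S \<union> y ` S)"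
    using cont by (auto intro!: compact_imp_bounded compact_continuous_image)
  then obtain K where K: "K-lipschitz_on (x ` S \<union> y ` S) V" "K \<ge> 0"
    by (rule boundedly_lipschitzE[OF V])
  define D where "D \<tau> = (x \<tau> - y \<tau>) \<bullet> (x \<tau> - y \<tau>)" for \<tau>
  define D' where "D' \<tau> = 2 * ((x \<tau> - y \<tau>) \<bullet> (V (x \<tau>) - V (y \<tau>)))" for \<tau>
  have D0: "D \<tau> \<ge> 0" for \<tau>
    by (simp add: D_def)
  have bound: "\<bar>D' \<tau>\<bar> \<le> 2 * K * D \<tau>" if "\<tau> \<in> S" for \<tau>
  proof -
    have "\<bar>(x \<tau> - y \<tau>) \<bullet> (V (x \<tau>) - V (y \<tau>))\<bar> \<le> norm (x \<tau> - y \<tau>) * norm (V (x \<tau>) - V (y \<tau>))"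
      by (rule Cauchy_Schwarz_ineq2)
    also have "\<dots> \<le> norm (x \<tau> - y \<tau>) * (K * norm (x \<tau> - y \<tau>))"
      using lipschitz_on_normD[OF K(1), of "x \<tau>" "y \<tau>"] that by (intro mult_left_mono) auto
    finally show ?thesis
      by (simp add: D_def D'_def dot_square_norm power2_eq_square algebra_simps abs_mult)
  qed
  have der: "(D has_real_derivative D' \<tau>) (at \<tau>)" if "min a t < \<tau>" "\<tau> < max a t" for \<tau>
  proof -
    have "\<tau> \<in> interior S"
      using that by (simp add: S_def)
    then have "(x has_vector_derivative V (x \<tau>)) (at \<tau>)" "(y has_vector_derivative V (y \<tau>)) (at \<tau>)"
      using xS yS unfolding solves_on_def
      by (metis at_within_interior interior_subset subsetD)+
    then have "((\<lambda>\<tau>. x \<tau> - y \<tau>) has_derivative (\<lambda>h. h *\<^sub>R (V (x \<tau>) - V (y \<tau>)))) (at \<tau>)"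
      unfolding has_vector_derivative_def[symmetric] by (rule has_vector_derivative_diff)
    from has_derivative_inner[OF this this] show ?thesis
      unfolding D_def D'_def has_field_derivative_def
      by (rule has_derivative_eq_rhs) (auto simp: fun_eq_iff inner_commute algebra_simps)
  qed
  have contD: "continuous_on S D"
    unfolding D_def by (intro continuous_intros cont)
  have "D t \<le> 0"
  proof (cases "a \<le> t")
    case True
    have "D t * exp (- 2 * K * t) \<le> D a * exp (- 2 * K * a)"
    proof (rule DERIV_nonpos_imp_decreasing_open[OF True, where f="\<lambda>\<tau>. D \<tau> * exp (- 2 * K * \<tau>)"])
      fix \<tau> assume \<tau>: "a < \<tau>" "\<tau> < t"
      have "((\<lambda>\<tau>. D \<tau> * exp (- 2 * K * \<tau>)) has_real_derivative (D' \<tau> - 2 * K * D \<tau>) * exp (- 2 * K * \<tau>)) (at \<tau>)"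
        using \<tau> by (auto intro!: derivative_eq_intros der simp: algebra_simps)
      moreover have "D' \<tau> - 2 * K * D \<tau> \<le> 0"
        using bound[of \<tau>] \<tau> by (auto simp: S_def)
      ultimately show "\<exists>y. ((\<lambda>\<tau>. D \<tau> * exp (- 2 * K * \<tau>)) has_real_derivative y) (at \<tau>) \<and> y \<le> 0"
        by (meson exp_ge_zero mult_nonpos_nonneg)
    qed (use contD True in \<open>auto intro!: continuous_intros simp: S_def\<close>)
    then show ?thesis
      using eq by (simp add: D_def mult_le_0_iff not_le)
  next
    case False
    then have le: "t \<le> a" by simp
    have "D t * exp (2 * K * t) \<le> D a * exp (2 * K * a)"
    proof (rule DERIV_nonneg_imp_increasing_open[OF le, where f="\<lambda>\<tau>. D \<tau> * exp (2 * K * \<tau>)"])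
      fix \<tau> assume \<tau>: "t < \<tau>" "\<tau> < a"
      have "((\<lambda>\<tau>. D \<tau> * exp (2 * K * \<tau>)) has_real_derivative (D' \<tau> + 2 * K * D \<tau>) * exp (2 * K * \<tau>)) (at \<tau>)"
        using \<tau> by (auto intro!: derivative_eq_intros der simp: algebra_simps)
      moreover have "D' \<tau> + 2 * K * D \<tau> \<ge> 0"
        using bound[of \<tau>] \<tau> by (auto simp: S_def)
      ultimately show "\<exists>y. ((\<lambda>\<tau>. D \<tau> * exp (2 * K * \<tau>)) has_real_derivative y) (at \<tau>) \<and> 0 \<le> y"
        by (meson exp_ge_zero mult_nonneg_nonneg)
    qed (use contD le in \<open>auto intro!: continuous_intros simp: S_def\<close>)
    then show ?thesis
      using eq by (simp add: D_def mult_le_0_iff not_le)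
  qed
  then show ?thesis
    using inner_gt_zero_iff[of "x t - y t"] unfolding D_def
    by (metis not_less eq_iff_diff_eq_0)
qed

text \<open>
The solution is sought as \<open>x\<^sub>0 + exp (c t) u(t)\<close> with \<open>u\<close> bounded and continuous.  For \<open>c > K\<close> the
exponential weight makes the integral operator a contraction on all of \<open>[0, \<infinity>)\<close>, so that a single
fixed point gives the global solution without gluing local ones.
\<close>

lemma picard_lindelof_bounded:
  fixes V :: "'a::euclidean_space \<Rightarrow> 'a"
  assumes K: "K-lipschitz_on UNIV V" and B: "\<And>x. norm (V x) \<le> B"
  shows "\<exists>w. solves_on {0..} V w \<and> w 0 = x0"
proof -
  have K0: "K \<ge> 0"
    using lipschitz_on_nonneg[OF K] .
  have B0: "B \<ge> 0"
    using B[of 0] norm_ge_zero order_trans by blast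
  \<comment> \<open>any rate above \<open>K\<close> makes the contraction factor \<open>K / c\<close> less than 1\<close>
  define c where "c = K + 1"
  have c: "c > 0" "K / c < 1" "K / c \<ge> 0"
    using K0 by (auto simp: c_def)
  define g where "g u \<tau> = V (x0 + exp (c * \<tau>) *\<^sub>R apply_bcontfun u \<tau>)" for u :: "real \<Rightarrow>\<^sub>C 'a" and \<tau>
  have contV: "continuous_on A V" for A
    using lipschitz_on_continuous_on[OF K] continuous_on_subset by blast
  have contg: "continuous_on A (g u)" for A u
    unfolding g_def
    by (intro continuous_on_compose2[OF contV[of UNIV]] continuous_intros continuous_on_apply_bcontfun) auto
  have antideriv: "\<exists>G. \<forall>t. (G has_vector_derivative g u t) (at t)" for u
    using einterval_antiderivative[of "-\<infinity>" "\<infinity>" "g u"] contg[of UNIV u]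
    by (auto simp: continuous_on_eq_continuous_at)
  define I where "I u t = integral {0..t} (g u)" for u t
  have I_deriv: "(I u has_vector_derivative g u t) (at t within {0..})" if "t \<ge> 0" for u t
  proof -
    obtain G where G: "\<And>t. (G has_vector_derivative g u t) (at t)"
      using antideriv by blast
    have I_eq: "I u \<tau> = G \<tau> - G 0" if "\<tau> \<ge> 0" for \<tau>
      unfolding I_def
      by (rule integral_unique, rule fundamental_theorem_of_calculus[OF that])
        (rule has_vector_derivative_at_within[OF G])
    have "((\<lambda>\<tau>. G \<tau> - G 0) has_vector_derivative g u t) (at t within {0..})"
      using has_vector_derivative_diff[OF has_vector_derivative_at_within[OF G] has_vector_derivative_const] by simp
    then show ?thesis
      by (rule has_vector_derivative_transform[rotated 2]) (use that I_eq in auto)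
  qed
  \<comment> \<open>frozen at its initial value for negative times, since bounded continuous functions live on the whole line\<close>
  define \<Phi> where "\<Phi> u t = exp (- c * max 0 t) *\<^sub>R I u (max 0 t)" for u t
  have cont\<Phi>: "continuous_on UNIV (\<Phi> u)" for u
  proof -
    have "continuous_on {0..} (I u)"
      unfolding continuous_on_eq_continuous_within using I_deriv has_vector_derivative_continuous by blast
    then have "continuous_on UNIV (\<lambda>t. I u (max 0 t))"
      by (rule continuous_on_compose2) (auto intro: continuous_intros)
    then show ?thesis
      unfolding \<Phi>_def by (intro continuous_intros)
  qed
  have bound\<Phi>: "norm (\<Phi> u t) \<le> B / c" for u t
  proof -
    define r where "r = max 0 t"
    have "norm (I u r) \<le> B * r"
      unfolding I_def
      using integral_bound[of 0 r "g u" B] contg B by (auto simp: r_def g_def)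
    then have "norm (\<Phi> u t) \<le> exp (- c * r) * (B * r)"
      by (simp add: \<Phi>_def r_def)
    also have "exp (- c * r) * (B * r) = B / c * (c * r / exp (c * r))"
      using c by (simp add: exp_minus field_simps)
    also have "\<dots> \<le> B / c * 1"
    proof (rule mult_left_mono)
      have "c * r \<le> exp (c * r)"
        using exp_ge_add_one_self[of "c * r"] by linarith
      then show "c * r / exp (c * r) \<le> 1" by simp
    qed (use B0 c in simp)
    finally show ?thesis by simp
  qed
  have contraction: "norm (\<Phi> u t - \<Phi> v t) \<le> K / c * dist u v" for u v t
  proof -
    define r where "r = max 0 t"
    have r: "r \<ge> 0" by (simp add: r_def)
    have int: "((\<lambda>\<tau>. K * dist u v * exp (c * \<tau>)) has_integral
        (K * dist u v * (exp (c * r) / c) - K * dist u v * (exp (c * 0) / c))) {0..r}"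
      using r c by (intro fundamental_theorem_of_calculus)
        (auto intro!: derivative_eq_intros simp flip: has_real_derivative_iff_has_vector_derivative)
    have "I u r - I v r = integral {0..r} (\<lambda>\<tau>. g u \<tau> - g v \<tau>)"
      unfolding I_def by (rule Henstock_Kurzweil_Integration.integral_diff[symmetric]) (intro integrable_continuous_real contg)+
    also have "norm \<dots> \<le> integral {0..r} (\<lambda>\<tau>. K * dist u v * exp (c * \<tau>))"
    proof (rule integral_norm_bound_integral)
      fix \<tau> assume "\<tau> \<in> {0..r}"
      have "norm (g u \<tau> - g v \<tau>) \<le> K * norm (exp (c * \<tau>) *\<^sub>R (u \<tau> - v \<tau>))"
        using lipschitz_on_normD[OF K, of "x0 + exp (c * \<tau>) *\<^sub>R u \<tau>" "x0 + exp (c * \<tau>) *\<^sub>R v \<tau>"]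
        by (simp add: g_def algebra_simps)
      also have "\<dots> \<le> K * (exp (c * \<tau>) * dist u v)"
        using dist_bounded[of u \<tau> v] K0 by (intro mult_left_mono) (auto simp: dist_norm)
      finally show "norm (g u \<tau> - g v \<tau>) \<le> K * dist u v * exp (c * \<tau>)"
        by (simp add: algebra_simps)
    qed (use int in \<open>auto intro!: integrable_continuous_real continuous_intros contg\<close>)
    also have "\<dots> = K * dist u v * (exp (c * r) / c) - K * dist u v * (exp (c * 0) / c)"
      using int by (rule integral_unique)
    also have "\<dots> \<le> K * dist u v * (exp (c * r) / c)"
      using K0 c by simp
    finally have "exp (- c * r) * norm (I u r - I v r) \<le> exp (- c * r) * (K * dist u v * (exp (c * r) / c))"
      by (intro mult_left_mono) auto
    also have "\<dots> = K / c * dist u v"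
      using c by (simp add: exp_minus field_simps)
    finally show ?thesis
      by (simp add: \<Phi>_def r_def flip: scaleR_diff_right)
  qed
  have apply\<Phi>: "apply_bcontfun (Bcontfun (\<Phi> u)) = \<Phi> u" for u
    by (rule Bcontfun_inverse) (rule bcontfun_normI[OF cont\<Phi> bound\<Phi>])
  have "\<exists>!u. Bcontfun (\<Phi> u) = u"
  proof (rule banach_fix_type[OF c(3) c(2)], intro allI)
    show "dist (Bcontfun (\<Phi> u)) (Bcontfun (\<Phi> v)) \<le> K / c * dist u v" for u v
      by (rule dist_bound) (use contraction in \<open>simp add: apply\<Phi> dist_norm[of "\<Phi> _ _"]\<close>)
  qed
  then obtain u where "Bcontfun (\<Phi> u) = u" by blast
  then have u: "apply_bcontfun u t = \<Phi> u t" for t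
    by (metis apply\<Phi>)
  have gI: "g u t = V (x0 + I u t)" if "t \<ge> 0" for t
    using that by (simp add: g_def u \<Phi>_def exp_minus)
  have "solves_on {0..} V (\<lambda>t. x0 + I u t)"
    unfolding solves_on_def
  proof
    fix t :: real assume "t \<in> {0..}"
    then show "((\<lambda>t. x0 + I u t) has_vector_derivative V (x0 + I u t)) (at t within {0..})"
      using has_vector_derivative_add[OF has_vector_derivative_const I_deriv[of t u]] gI[of t] by simp
  qed
  moreover have "x0 + I u 0 = x0"
    by (simp add: I_def)
  ultimately show ?thesis by blast
qed

lemma lyapunov_nonincreasing:
  fixes w :: "real \<Rightarrow> 'a::real_normed_vector" and E :: "'a \<Rightarrow> real"
  assumes w: "solves_on {0..} V w"
    and E: "\<And>x. (E has_derivative E' x) (at x)"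
    and decr: "\<And>x. E' x (V x) \<le> 0"
    and st: "0 \<le> s" "s \<le> t"
  shows "E (w t) \<le> E (w s)"
proof (rule DERIV_nonpos_imp_decreasing_open[OF st(2), where f="\<lambda>t. E (w t)"])
  have contw: "continuous_on {s..t} w"
    using solves_on_imp_continuous_on[OF w] by (rule continuous_on_subset) (use st in auto)
  have contE: "continuous_on UNIV E"
    by (simp add: continuous_at_imp_continuous_on has_derivative_continuous[OF E])
  show "continuous_on {s..t} (\<lambda>t. E (w t))"
    by (rule continuous_on_compose2[OF contE contw]) simp
next
  fix \<tau> assume \<tau>: "s < \<tau>" "\<tau> < t"
  have "(w has_derivative (\<lambda>h. h *\<^sub>R V (w \<tau>))) (at \<tau>)"
    using w[unfolded solves_on_def, rule_format, of \<tau>] \<tau> st at_within_interior[of \<tau> "{0..}"]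
    by (simp add: has_vector_derivative_def)
  from has_derivative_compose[OF this E]
  have "((\<lambda>\<tau>. E (w \<tau>)) has_real_derivative E' (w \<tau>) (V (w \<tau>))) (at \<tau>)"
    unfolding has_field_derivative_def
    by (rule has_derivative_eq_rhs)
      (simp add: fun_eq_iff linear_scale[OF has_derivative_linear[OF E]])
  then show "\<exists>y. ((\<lambda>t. E (w t)) has_real_derivative y) (at \<tau>) \<and> y \<le> 0"
    using decr by blast
qed

text \<open>
The field is multiplied by a cutoff \<open>\<mu>\<close> that equals 1 on the sublevel set of the initial point and
vanishes far away; the product is bounded and globally Lipschitz.  Since \<open>\<mu> \<ge> 0\<close>, the function
\<open>E\<close> decreases along the modified field everywhere.  Its trajectory therefore never leaves the
sublevel set, where both fields agree.
\<close>

lemma solution_exists_of_lyapunov: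
  fixes V :: "'a::euclidean_space \<Rightarrow> 'a" and E :: "'a \<Rightarrow> real"
  assumes V: "boundedly_lipschitz V"
    and E: "\<And>x. (E has_derivative E' x) (at x)"
    and decr: "\<And>x. E' x (V x) \<le> 0"
    and proper: "bounded {x. E x \<le> E x0}"
  shows "\<exists>w. solves_on {0..} V w \<and> w 0 = x0 \<and> (\<forall>t\<ge>0. E (w t) \<le> E x0)"
proof -
  obtain R where R: "R > 0" "\<And>x. E x \<le> E x0 \<Longrightarrow> norm x \<le> R"
    using proper unfolding bounded_pos by auto
  define \<mu> :: "'a \<Rightarrow> real" where "\<mu> x = max 0 (min 1 (R + 1 - norm x))" for x
  \<comment> \<open>composing with the 1-Lipschitz projection onto the ball makes \<open>V\<close> bounded and Lipschitz on the
    whole space; where it changes \<open>V\<close>, the cutoff is 0\<close>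
  define P :: "'a \<Rightarrow> 'a" where "P = closest_point (cball 0 (R + 1))"
  define W where "W x = \<mu> x *\<^sub>R V (P x)" for x
  have P_mem: "P x \<in> cball 0 (R + 1)" for x
    unfolding P_def using R(1) by (intro closest_point_in_set) auto
  have W_eq: "W x = \<mu> x *\<^sub>R V x" for x
  proof (cases "norm x \<le> R + 1")
    case True
    then show ?thesis by (simp add: W_def P_def closest_point_self)
  next
    case False
    then show ?thesis by (simp add: W_def \<mu>_def)
  qed
  obtain K where K: "K-lipschitz_on (cball 0 (R + 1)) V" "K \<ge> 0"
    using boundedly_lipschitzE[OF V bounded_cball] .
  obtain B where B: "B > 0" "\<And>x. x \<in> cball 0 (R + 1) \<Longrightarrow> norm (V x) \<le> B"
    using boundedly_lipschitz_bounded_image[OF V bounded_cball[of 0 "R + 1"]]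
    unfolding bounded_pos by (metis imageI)
  have \<mu>: "0 \<le> \<mu> x" "\<mu> x \<le> 1" for x
    by (auto simp: \<mu>_def)
  have \<mu>_lip: "\<bar>\<mu> x - \<mu> y\<bar> \<le> dist x y" for x y
    using norm_triangle_ineq3[of x y] by (auto simp: \<mu>_def dist_norm abs_le_iff)
  have "norm (W x) \<le> B" for x
    unfolding W_def using \<mu>[of x] B(2)[OF P_mem[of x]] B(1)
    by (simp add: mult_mono[of "\<mu> x" 1 "norm (V (P x))" B, simplified])
  moreover have "(K + B)-lipschitz_on UNIV W"
  proof (rule lipschitz_onI)
    fix x y
    have "norm (V (P x) - V (P y)) \<le> K * dist (P x) (P y)"
      using lipschitz_onD[OF K(1) P_mem P_mem] by (simp add: dist_norm)
    also have "\<dots> \<le> K * dist x y"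
      unfolding P_def using R(1) K(2)
      by (intro mult_left_mono closest_point_lipschitz) auto
    finally have VP: "norm (V (P x) - V (P y)) \<le> K * dist x y" .
    have "W x - W y = \<mu> x *\<^sub>R (V (P x) - V (P y)) + (\<mu> x - \<mu> y) *\<^sub>R V (P y)"
      by (simp add: W_def algebra_simps)
    then have "norm (W x - W y) \<le> \<mu> x * norm (V (P x) - V (P y)) + \<bar>\<mu> x - \<mu> y\<bar> * norm (V (P y))"
      using norm_triangle_ineq \<mu>(1)[of x] by (metis norm_scaleR abs_of_nonneg)
    also have "\<dots> \<le> 1 * (K * dist x y) + dist x y * B"
      using \<mu>[of x] \<mu>_lip[of x y] VP B(2)[OF P_mem[of y]] by (intro add_mono mult_mono) auto
    finally show "dist (W x) (W y) \<le> (K + B) * dist x y"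
      by (simp add: dist_norm algebra_simps)
  qed (use K B in simp)
  ultimately obtain w where w: "solves_on {0..} W w" "w 0 = x0"
    using picard_lindelof_bounded by blast
  have "E' x (W x) \<le> 0" for x
    using decr[of x] \<mu>(1)[of x] linear_scale[OF has_derivative_linear[OF E], of x "\<mu> x" "V x"]
    by (simp add: W_eq mult_nonneg_nonpos)
  from lyapunov_nonincreasing[OF w(1) E this]
  have le: "E (w t) \<le> E x0" if "t \<ge> 0" for t
    using that w(2) by fastforce
  have "W (w t) = V (w t)" if "t \<ge> 0" for t
    using R(2)[OF le[OF that]] by (simp add: W_eq \<mu>_def)
  then have "solves_on {0..} V w"
    using w(1) by (simp add: solves_on_def)
  then show ?thesis
    using w(2) le by blast
qed

section \<open>Limit points of bounded trajectories\<close>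

text \<open>
If \<open>A \<circ> w\<close> stayed away from \<open>c\<close> along some sequence of times, then a convergent subsequence, which
exists since \<open>w\<close> is bounded, would give a limit point \<open>z\<close> with \<open>A z \<noteq> c\<close>.
\<close>

lemma tendsto_of_limit_points:
  fixes w :: "real \<Rightarrow> 'a::euclidean_space" and A :: "'a \<Rightarrow> 'b::metric_space"
  assumes w: "bounded (w ` {0..})" and A: "continuous_on UNIV A"
    and lim: "\<And>T z. filterlim T at_top sequentially \<Longrightarrow> (\<lambda>n. w (T n)) \<longlonglongrightarrow> z \<Longrightarrow> A z = c"
  shows "((\<lambda>t. A (w t)) \<longlongrightarrow> c) at_top"
proof (rule ccontr)
  assume "\<not> ?thesis"
  then obtain \<epsilon> where \<epsilon>: "\<epsilon> > 0" "\<not> (\<forall>\<^sub>F t in at_top. dist (A (w t)) c < \<epsilon>)"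
    unfolding tendsto_iff by blast
  then have "\<forall>n. \<exists>t\<ge>real n. dist (A (w t)) c \<ge> \<epsilon>"
    unfolding eventually_at_top_linorder by (meson not_less)
  then obtain T where T: "\<And>n. T n \<ge> real n" "\<And>n. dist (A (w (T n))) c \<ge> \<epsilon>"
    by metis
  have "range (\<lambda>n. w (T n)) \<subseteq> w ` {0..}"
    using T(1) by (auto intro: order_trans[OF of_nat_0_le_iff])
  then obtain z r where r: "strict_mono r" "((\<lambda>n. w (T n)) \<circ> r) \<longlonglongrightarrow> z"
    using bounded_imp_convergent_subsequence[OF bounded_subset[OF w]] by blast
  then have wz: "(\<lambda>n. w (T (r n))) \<longlonglongrightarrow> z"
    by (simp add: o_def)
  have "filterlim T at_top sequentially"
    using filterlim_at_top_mono[OF filterlim_real_sequentially] T(1) by (simp add: always_eventually)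
  then have "filterlim (\<lambda>n. T (r n)) at_top sequentially"
    by (rule filterlim_compose[OF _ filterlim_subseq[OF r(1)]])
  then have "A z = c"
    using lim wz by blast
  moreover have "(\<lambda>n. A (w (T (r n)))) \<longlonglongrightarrow> A z"
    using A wz by (auto intro: continuous_on_tendsto_compose[of UNIV A])
  then have "(\<lambda>n. dist (A (w (T (r n)))) c) \<longlonglongrightarrow> dist (A z) c"
    by (intro tendsto_intros)
  then have "dist (A z) c \<ge> \<epsilon>"
    by (rule tendsto_lowerbound) (use T(2) in auto)
  ultimately show False
    using \<epsilon>(1) by simp
qed

text \<open>
A form of LaSalle's principle that avoids the flow on the limit set.  If \<open>w\<close> is close to \<open>z\<close> at the
time \<open>T n\<close>, then its bounded speed keeps it close during a time \<open>\<delta>\<close> independent of \<open>n\<close>.  Meanwhile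
\<open>u\<close> changes by about \<open>\<delta> W z\<close>; since \<open>u\<close> converges, this change must tend to 0.
\<close>

lemma derivative_vanishes_at_limit_points:
  fixes w :: "real \<Rightarrow> 'a::real_normed_vector" and u :: "real \<Rightarrow> 'b::real_normed_vector"
  assumes w: "B-lipschitz_on {0..} w"
    and u: "\<And>t. t \<ge> 0 \<Longrightarrow> (u has_vector_derivative W (w t)) (at t within {0..})"
    and lim: "(u \<longlongrightarrow> l) at_top"
    and W: "isCont W z"
    and T: "filterlim T at_top sequentially" and wT: "(\<lambda>n. w (T n)) \<longlonglongrightarrow> z"
  shows "W z = 0"
proof -
  have "norm (W z) \<le> \<epsilon>" if "\<epsilon> > 0" for \<epsilon>
  proof -
    have B: "B \<ge> 0" using lipschitz_on_nonneg[OF w] .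
    obtain \<eta> where \<eta>: "\<eta> > 0" "\<And>v. dist v z < \<eta> \<Longrightarrow> dist (W v) (W z) < \<epsilon>"
      using W \<open>\<epsilon> > 0\<close> unfolding continuous_at_eps_delta by blast
    define \<delta> where "\<delta> = \<eta> / (2 * (B + 1))"
    have \<delta>: "\<delta> > 0" "B * \<delta> < \<eta> / 2"
      using \<eta>(1) B by (auto simp: \<delta>_def field_simps)
    have ev: "\<forall>\<^sub>F n in sequentially. norm (u (T n + \<delta>) - u (T n) - \<delta> *\<^sub>R W z) \<le> \<delta> * \<epsilon>"
    proof -
      have "\<forall>\<^sub>F n in sequentially. dist (w (T n)) z < \<eta> / 2"
        using tendstoD[OF wT, of "\<eta> / 2"] \<eta>(1) by simp
      moreover have "\<forall>\<^sub>F n in sequentially. T n \<ge> 0"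
        using T by (simp add: filterlim_at_top)
      ultimately show ?thesis
      proof eventually_elim
        case (elim n)
        have "norm ((u (T n + \<delta>) - (T n + \<delta>) *\<^sub>R W z) - (u (T n) - T n *\<^sub>R W z)) \<le> \<epsilon> * norm (T n + \<delta> - T n)"
        proof (rule differentiable_bound[where S = "{T n..T n + \<delta>}"])
          fix \<tau> assume \<tau>: "\<tau> \<in> {T n..T n + \<delta>}"
          have "((\<lambda>\<tau>. u \<tau> - \<tau> *\<^sub>R W z) has_vector_derivative W (w \<tau>) - W z) (at \<tau> within {0..})"
            using \<tau> elim(2)
            by (intro has_vector_derivative_diff u has_vector_derivative_scaleR[OF DERIV_ident has_vector_derivative_const, THEN has_vector_derivative_eq_rhs]) auto
          then have "((\<lambda>\<tau>. u \<tau> - \<tau> *\<^sub>R W z) has_vector_derivative W (w \<tau>) - W z) (at \<tau> within {T n..T n + \<delta>})"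
            by (rule has_vector_derivative_within_subset) (use elim(2) in auto)
          then show "((\<lambda>\<tau>. u \<tau> - \<tau> *\<^sub>R W z) has_derivative (\<lambda>h. h *\<^sub>R (W (w \<tau>) - W z)))
              (at \<tau> within {T n..T n + \<delta>})"
            by (simp add: has_vector_derivative_def)
          have "dist (w \<tau>) (w (T n)) \<le> B * dist \<tau> (T n)"
            using lipschitz_onD[OF w, of \<tau> "T n"] \<tau> elim(2) by simp
          also have "\<dots> \<le> B * \<delta>"
            using \<tau> B by (intro mult_left_mono) (auto simp: dist_real_def)
          finally have "dist (w \<tau>) z < \<eta>"
            using \<delta>(2) elim(1) dist_triangle[of "w \<tau>" z "w (T n)"] by linarith
          then have "norm (W (w \<tau>) - W z) \<le> \<epsilon>"
            using \<eta>(2) by (fastforce simp: dist_norm)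
          then show "onorm (\<lambda>h::real. h *\<^sub>R (W (w \<tau>) - W z)) \<le> \<epsilon>"
            by (intro onorm_le) (auto simp: mult.commute[of \<epsilon>] intro: mult_left_mono)
        qed (use \<delta>(1) in auto)
        then show ?case
          using \<delta>(1) by (simp add: algebra_simps)
      qed
    qed
    have T\<delta>: "filterlim (\<lambda>n. T n + \<delta>) at_top sequentially"
      by (rule filterlim_at_top_mono[OF T]) (use \<delta>(1) in simp)
    have "(\<lambda>n. norm (u (T n + \<delta>) - u (T n) - \<delta> *\<^sub>R W z)) \<longlonglongrightarrow> norm (l - l - \<delta> *\<^sub>R W z)"
      by (intro tendsto_intros filterlim_compose[OF lim] T\<delta> T)
    from tendsto_upperbound[OF this ev] have "\<delta> * norm (W z) \<le> \<delta> * \<epsilon>"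
      using \<delta>(1) by simp
    then show ?thesis
      using \<delta>(1) by simp
  qed
  then have "norm (W z) \<le> 0"
    using field_le_epsilon[of "norm (W z)" 0] by simp
  then show ?thesis by simp
qed

section \<open>Gradients and tangent inequalities of convex concave functions\<close>

text \<open>
The representation of \<open>f' x\<close> by the vector \<open>\<Sum>b\<in>Basis. f' x b *\<^sub>R b\<close> is linear in \<open>f' x\<close>, so the gradient
inherits the Lipschitz bound that the continuous second derivative gives for \<open>f'\<close>.
\<close>

lemma C2_gradient:
  fixes f :: "'a::euclidean_space \<Rightarrow> real"
  assumes "C2 f"
  shows C2_imp_GDERIV: "GDERIV f x :> grad f x"
    and C2_imp_boundedly_lipschitz_grad: "boundedly_lipschitz (grad f)"
proof -
  obtain f' :: "'a \<Rightarrow> 'a \<Rightarrow>\<^sub>L real" and f'' :: "'a \<Rightarrow> 'a \<Rightarrow>\<^sub>L 'a \<Rightarrow>\<^sub>L real"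
    where f': "\<And>x. (f has_derivative blinfun_apply (f' x)) (at x)"
      and f'': "\<And>x. (f' has_derivative blinfun_apply (f'' x)) (at x)" "continuous_on UNIV f''"
    using assms unfolding C2_def by blast
  define D where "D x = (\<Sum>b\<in>Basis. blinfun_apply (f' x) b *\<^sub>R b)" for x
  have D: "blinfun_apply (f' x) v = v \<bullet> D x" for x v
  proof -
    have "blinfun_apply (f' x) v = blinfun_apply (f' x) (\<Sum>b\<in>Basis. (v \<bullet> b) *\<^sub>R b)"
      by (simp add: euclidean_representation)
    also have "\<dots> = v \<bullet> D x"
      by (simp add: D_def blinfun.sum_right blinfun.scaleR_right inner_sum_right mult.commute)
    finally show ?thesis .
  qed
  have GD: "GDERIV f x :> D x" for x
    using f'[of x] unfolding gderiv_def D .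
  have uniq: "D' = D x" if "GDERIV f x :> D'" for D' x
  proof -
    have "(\<lambda>v. v \<bullet> D') = (\<lambda>v. v \<bullet> D x)"
      using has_derivative_unique that GD unfolding gderiv_def by blast
    then show ?thesis
      by (metis vector_eq_ldot)
  qed
  have grad_eq: "grad f = D"
    unfolding grad_def using GD uniq by (intro ext the_equality) auto
  show "GDERIV f x :> grad f x"
    unfolding grad_eq by (rule GD)
  have "bounded_linear (\<lambda>F::'a \<Rightarrow>\<^sub>L real. blinfun_apply F b *\<^sub>R b)" for b
    by (rule bounded_linear_compose[OF bounded_linear_scaleR_left blinfun.bounded_linear_left])
  then show "boundedly_lipschitz (grad f)"
    unfolding grad_eq D_def
    by (intro boundedly_lipschitz_sum finite_Basis
        boundedly_lipschitz_linear_compose[where A = "\<lambda>F. blinfun_apply F _ *\<^sub>R _"]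
        boundedly_lipschitz_of_blinfun_derivative[OF f''])
qed

text \<open>
Restriction to the line through \<open>x\<close> and \<open>y\<close> reduces this to the inequality in one variable.
\<close>

lemma convex_on_imp_above_tangent_hyperplane:
  fixes \<phi> :: "'a::real_normed_vector \<Rightarrow> real"
  assumes \<phi>: "convex_on UNIV \<phi>" and D: "(\<phi> has_derivative D) (at x)"
  shows "\<phi> x + D (y - x) \<le> \<phi> y"
proof -
  define \<psi> where "\<psi> t = \<phi> (x + t *\<^sub>R (y - x))" for t :: real
  have "convex_on UNIV \<psi>"
  proof (rule convex_onI)
    fix t a b :: real assume t: "0 < t" "t < 1"
    have "x + ((1 - t) *\<^sub>R a + t *\<^sub>R b) *\<^sub>R (y - x)
        = (1 - t) *\<^sub>R (x + a *\<^sub>R (y - x)) + t *\<^sub>R (x + b *\<^sub>R (y - x))"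
      by (simp add: algebra_simps)
    then show "\<psi> ((1 - t) *\<^sub>R a + t *\<^sub>R b) \<le> (1 - t) * \<psi> a + t * \<psi> b"
      unfolding \<psi>_def using convex_onD[OF \<phi>, of t] t by simp
  qed simp
  moreover have "(\<psi> has_real_derivative D (y - x)) (at 0)"
  proof -
    have "((\<lambda>t. x + t *\<^sub>R (y - x)) has_derivative (\<lambda>h. h *\<^sub>R (y - x))) (at 0)"
      by (auto intro!: derivative_eq_intros)
    from has_derivative_compose[OF this, of \<phi> D] D show ?thesis
      unfolding \<psi>_def has_field_derivative_def
      by (auto simp: linear_scale[OF has_derivative_linear[OF D]] mult.commute elim!: has_derivative_eq_rhs)
  qed
  ultimately have "\<psi> 1 - \<psi> 0 \<ge> D (y - x) * (1 - 0)"
    by (intro convex_on_imp_above_tangent[where A = UNIV]) auto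
  then show ?thesis
    by (simp add: \<psi>_def)
qed

lemma strictly_convex_minimum_unique:
  fixes \<phi> :: "'a::real_vector \<Rightarrow> real"
  assumes sc: "strictly_convex \<phi>" and min: "\<And>x. \<phi> p \<le> \<phi> x" and "\<phi> a = \<phi> p"
  shows "a = p"
proof (rule ccontr)
  assume "a \<noteq> p"
  then have "\<phi> ((1 - 1/2) *\<^sub>R a + (1/2) *\<^sub>R p) < (1 - 1/2) * \<phi> a + (1/2) * \<phi> p"
    using sc unfolding strictly_convex_def by (metis half_gt_zero_iff less_numeral_extra(1) one_less_numeral_iff semiring_norm(76) divide_less_eq_1_pos zero_less_numeral)
  then show False
    using min[of "(1 - 1/2) *\<^sub>R a + (1/2) *\<^sub>R p"] assms(3) by simp
qed

lemma C2_partial_derivatives: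
  fixes L :: "'a::euclidean_space \<times> 'b::euclidean_space \<Rightarrow> real"
  assumes "C2 L"
  shows C2_derivative_fst: "((\<lambda>x. L (x, y)) has_derivative (\<lambda>u. u \<bullet> fst (grad L (x, y)))) (at x)"
    and C2_derivative_snd: "((\<lambda>y. L (x, y)) has_derivative (\<lambda>v. v \<bullet> snd (grad L (x, y)))) (at y)"
proof -
  have L: "(L has_derivative (\<lambda>u. u \<bullet> grad L z)) (at z)" for z
    using C2_imp_GDERIV[OF assms] unfolding gderiv_def .
  have "((\<lambda>x. (x, y)) has_derivative (\<lambda>u. (u, 0))) (at x)"
    by (auto intro!: derivative_eq_intros)
  from has_derivative_compose[OF this L]
  show "((\<lambda>x. L (x, y)) has_derivative (\<lambda>u. u \<bullet> fst (grad L (x, y)))) (at x)"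
    by (simp add: inner_prod_def)
  have "((\<lambda>y. (x, y)) has_derivative (\<lambda>v. (0, v))) (at y)"
    by (auto intro!: derivative_eq_intros)
  from has_derivative_compose[OF this L]
  show "((\<lambda>y. L (x, y)) has_derivative (\<lambda>v. v \<bullet> snd (grad L (x, y)))) (at y)"
    by (simp add: inner_prod_def)
qed

lemma convex_concave_inequalities:
  fixes L :: "'a::euclidean_space \<times> 'b::euclidean_space \<Rightarrow> real"
  assumes "C2 L" "convex_concave L"
  shows convex_tangent_fst: "L (x, y) + (x' - x) \<bullet> fst (grad L (x, y)) \<le> L (x', y)"
    and concave_tangent_snd: "L (x, y') \<le> L (x, y) + (y' - y) \<bullet> snd (grad L (x, y))"
proof -
  show "L (x, y) + (x' - x) \<bullet> fst (grad L (x, y)) \<le> L (x', y)"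
    using convex_on_imp_above_tangent_hyperplane[OF _ C2_derivative_fst[OF assms(1)], of y x x'] assms(2)
    by (simp add: convex_concave_def)
  have "convex_on UNIV (\<lambda>y. - L (x, y))"
    using assms(2) by (simp add: convex_concave_def concave_on_def)
  from convex_on_imp_above_tangent_hyperplane[OF this has_derivative_minus[OF C2_derivative_snd[OF assms(1)]], of y y']
  show "L (x, y') \<le> L (x, y) + (y' - y) \<bullet> snd (grad L (x, y))"
    by simp
qed

section \<open>Coercive potentials of increasing maps\<close>

text \<open>
Potentials of this kind add up: as they are nonnegative, a sublevel set of \<open>E (s) + E' (r)\<close> lies in a
product of sublevel sets of \<open>E\<close> and \<open>E'\<close> and is bounded as well.
\<close>

definition coercive_potential :: "('a::euclidean_space \<Rightarrow> 'a) \<Rightarrow> 'a \<Rightarrow> ('a \<Rightarrow> real) \<Rightarrow> bool" where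
  "coercive_potential h p E \<longleftrightarrow>
     (\<forall>s. (E has_derivative (\<lambda>v. v \<bullet> (h s - p))) (at s)) \<and> (\<forall>s. 0 \<le> E s) \<and>
     (\<forall>a. bounded {s. E s \<le> a})"

text \<open>
The potential is the integral of \<open>\<phi> - p\<close> from \<open>s\<^sub>0\<close>.  The integrand has the sign of \<open>s - s\<^sub>0\<close>, and
outside \<open>[s\<^sub>0 - 1, s\<^sub>0 + 1]\<close> its absolute value is at least a constant \<open>c > 0\<close>, so the integral grows at
least linearly in both directions.
\<close>

lemma scalar_coercive_potential:
  fixes \<phi> :: "real \<Rightarrow> real"
  assumes mono: "strict_mono \<phi>" and cont: "continuous_on UNIV \<phi>" and p: "\<phi> s0 = p"
  obtains e where "\<And>s. (e has_real_derivative \<phi> s - p) (at s)" "\<And>s. 0 \<le> e s" "\<And>a. bounded {s. e s \<le> a}"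
proof -
  have "\<exists>F. \<forall>s. (F has_vector_derivative \<phi> s - p) (at s)"
    using einterval_antiderivative[of "-\<infinity>" "\<infinity>" "\<lambda>s. \<phi> s - p"] cont
    by (auto simp: continuous_on_eq_continuous_at intro!: continuous_intros)
  then obtain F where F: "\<And>s. (F has_real_derivative \<phi> s - p) (at s)"
    by (auto simp: has_real_derivative_iff_has_vector_derivative)
  define e where "e s = F s - F s0" for s
  have e: "(e has_real_derivative \<phi> s - p) (at s)" for s
    unfolding e_def by (auto intro!: derivative_eq_intros F)
  have right: "e s' + c * (s - s') \<le> e s" if "s' \<le> s" "c \<le> \<phi> s' - p" for s s' c
  proof -
    have "e s' - c * s' \<le> e s - c * s"
    proof (rule DERIV_nonneg_imp_nondecreasing[OF that(1), where f = "\<lambda>s. e s - c * s"])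
      fix x assume "s' \<le> x"
      then have "\<phi> s' \<le> \<phi> x"
        using mono by (simp add: strict_mono_less_eq)
      moreover have "((\<lambda>s. e s - c * s) has_real_derivative \<phi> x - p - c) (at x)"
        by (auto intro!: derivative_eq_intros e)
      ultimately show "\<exists>y. ((\<lambda>s. e s - c * s) has_real_derivative y) (at x) \<and> 0 \<le> y"
        using that(2) by (intro exI conjI) auto
    qed
    then show ?thesis by (simp add: algebra_simps)
  qed
  have left: "e s' + c * (s' - s) \<le> e s" if "s \<le> s'" "c \<le> p - \<phi> s'" for s s' c
  proof -
    have "e s' + c * s' \<le> e s + c * s"
    proof (rule DERIV_nonpos_imp_nonincreasing[OF that(1), where f = "\<lambda>s. e s + c * s"])
      fix x assume "x \<le> s'"
      then have "\<phi> x \<le> \<phi> s'"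
        using mono by (simp add: strict_mono_less_eq)
      moreover have "((\<lambda>s. e s + c * s) has_real_derivative \<phi> x - p + c) (at x)"
        by (auto intro!: derivative_eq_intros e)
      ultimately show "\<exists>y. ((\<lambda>s. e s + c * s) has_real_derivative y) (at x) \<and> y \<le> 0"
        using that(2) by (intro exI conjI) auto
    qed
    then show ?thesis by (simp add: algebra_simps)
  qed
  have nonneg: "0 \<le> e s" for s
    using right[of s0 s 0] left[of s s0 0] p by (cases "s0 \<le> s") (auto simp: e_def)
  \<comment> \<open>the slope of the linear growth, positive because \<open>\<phi>\<close> is strictly increasing\<close>
  define c where "c = min (\<phi> (s0 + 1) - p) (p - \<phi> (s0 - 1))"
  have c: "c > 0"
    using strict_monoD[OF mono, of s0 "s0 + 1"] strict_monoD[OF mono, of "s0 - 1" s0] p by (simp add: c_def)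
  have c_le: "c \<le> \<phi> (s0 + 1) - p" "c \<le> p - \<phi> (s0 - 1)"
    by (simp_all add: c_def)
  have growth: "c * (\<bar>s - s0\<bar> - 1) \<le> e s" for s
  proof -
    consider "s \<ge> s0 + 1" | "s \<le> s0 - 1" | "\<bar>s - s0\<bar> \<le> 1" by linarith
    then show ?thesis
    proof cases
      case 1
      then show ?thesis
        using right[of "s0 + 1" s c] c_le nonneg[of "s0 + 1"] by (simp add: algebra_simps)
    next
      case 2
      then show ?thesis
        using left[of s "s0 - 1" c] c_le nonneg[of "s0 - 1"] by (simp add: algebra_simps)
    next
      case 3
      then have "c * (\<bar>s - s0\<bar> - 1) \<le> 0"
        using c by (intro mult_nonneg_nonpos) auto
      then show ?thesis using nonneg[of s] by linarith
    qed
  qed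
  have "bounded {s. e s \<le> a}" for a
  proof (rule bounded_subset[OF bounded_cball[of s0 "a / c + 1"]], rule subsetI)
    fix s assume "s \<in> {s. e s \<le> a}"
    then have "c * (\<bar>s - s0\<bar> - 1) \<le> a"
      using growth[of s] by simp
    then show "s \<in> cball s0 (a / c + 1)"
      using c by (simp add: dist_real_def abs_minus_commute field_simps)
  qed
  then show thesis
    using that e nonneg by blast
qed

lemma separable_coercive_potential:
  fixes \<phi> :: "'n::finite \<Rightarrow> real \<Rightarrow> real" and p :: "real^'n"
  assumes mono: "\<And>i. strict_mono (\<phi> i)" and cont: "\<And>i. continuous_on UNIV (\<phi> i)"
    and p: "\<And>i. p $ i \<in> range (\<phi> i)"
  obtains E where "coercive_potential (\<lambda>s. \<chi> i. \<phi> i (s $ i)) p E"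
proof -
  have "\<exists>e. (\<forall>s. (e has_real_derivative \<phi> i s - p $ i) (at s)) \<and> (\<forall>s. 0 \<le> e s) \<and> (\<forall>a. bounded {s. e s \<le> a})" for i
  proof -
    obtain s0 where "\<phi> i s0 = p $ i" using p[of i] by auto
    then show ?thesis
      using scalar_coercive_potential[OF mono cont, of i s0 "p $ i"] by metis
  qed
  then obtain e where e: "\<And>i s. (e i has_real_derivative \<phi> i s - p $ i) (at s)" "\<And>i s. 0 \<le> e i s"
    "\<And>i a. bounded {s. e i s \<le> a}"
    by metis
  define E where "E s = (\<Sum>i\<in>UNIV. e i (s $ i))" for s :: "real^'n"
  have "(E has_derivative (\<lambda>v. v \<bullet> ((\<chi> i. \<phi> i (s $ i)) - p))) (at s)" for s
  proof -
    have "((\<lambda>s. e i (s $ i)) has_derivative (\<lambda>v. (\<phi> i (s $ i) - p $ i) * v $ i)) (at s)" for i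
    proof -
      have "((\<lambda>s::real^'n. s $ i) has_derivative (\<lambda>v. v $ i)) (at s)"
        by (rule bounded_linear_imp_has_derivative[OF bounded_linear_vec_nth])
      from has_derivative_compose[OF this e(1)[of i, unfolded has_field_derivative_def]]
      show ?thesis .
    qed
    then have "(E has_derivative (\<lambda>v. \<Sum>i\<in>UNIV. (\<phi> i (s $ i) - p $ i) * v $ i)) (at s)"
      unfolding E_def by (rule has_derivative_sum)
    then show ?thesis
      by (simp add: inner_vec_def mult.commute)
  qed
  moreover have "0 \<le> E s" for s
    unfolding E_def by (intro sum_nonneg e)
  moreover have "bounded {s. E s \<le> a}" for a
  proof -
    have "\<exists>R. \<forall>s. e i s \<le> a \<longrightarrow> \<bar>s\<bar> \<le> R" for i
      using e(3)[of i a] by (auto simp: bounded_iff)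
    then obtain R where R: "\<And>i s. e i s \<le> a \<Longrightarrow> \<bar>s\<bar> \<le> R i"
      by metis
    have "norm s \<le> (\<Sum>i\<in>UNIV. R i)" if "E s \<le> a" for s
    proof -
      have "e i (s $ i) \<le> E s" for i
        unfolding E_def by (rule member_le_sum) (use e(2) in auto)
      then have "\<bar>s $ i\<bar> \<le> R i" for i
        using R that order_trans by blast
      then show ?thesis
        by (intro order_trans[OF norm_le_l1_cart] sum_mono)
    qed
    then show ?thesis
      unfolding bounded_iff by blast
  qed
  ultimately show thesis
    using that[of E] unfolding coercive_potential_def by blast
qed

section \<open>The dynamics in the time parameters\<close>

definition reduced_field ::
  "('a::euclidean_space \<times> 'b::euclidean_space \<Rightarrow> real) \<Rightarrow> ('a \<Rightarrow> 'a) \<Rightarrow> ('b \<Rightarrow> 'b) \<Rightarrow> 'a \<times> 'b \<Rightarrow> 'a \<times> 'b" where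
  "reduced_field L h k = (\<lambda>(s, r). (- fst (grad L (h s, k r)), snd (grad L (h s, k r))))"

text \<open>
The sum of the two potentials is the Lyapunov function; its derivative \<open>(x - p) \<bullet> (- \<nabla>\<^sub>x L) + (y - q) \<bullet> \<nabla>\<^sub>y L\<close>
at \<open>x = h s\<close>, \<open>y = k r\<close> is estimated by the tangent inequalities at \<open>(x, y)\<close> in the directions of
\<open>p\<close> and \<open>q\<close>.  The vanishing of a derivative at limit points is used twice: for the Lyapunov
function, and then for the component that it forces to converge.
\<close>

lemma reduced_field_converges:
  fixes L :: "'a::euclidean_space \<times> 'b::euclidean_space \<Rightarrow> real"
  assumes L: "C2 L" "strictly_convex_concave L"
    and pq: "(p, q) \<in> Solution L"
    and h: "boundedly_lipschitz h" "inj h" "coercive_potential h p Eh"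
    and k: "boundedly_lipschitz k" "inj k" "coercive_potential k q Ek"
  obtains w where "solves_on {0..} (reduced_field L h k) w" "w 0 = w0" "bounded (w ` {0..})"
    "\<And>T z. filterlim T at_top sequentially \<Longrightarrow> (\<lambda>n. w (T n)) \<longlonglongrightarrow> z \<Longrightarrow>
       (h (fst z), k (snd z)) \<in> Solution L"
proof -
  define V where "V = reduced_field L h k"
  define E where "E z = Eh (fst z) + Ek (snd z)" for z
  define E' where "E' z v = fst v \<bullet> (h (fst z) - p) + snd v \<bullet> (k (snd z) - q)" for z v
  have cc: "convex_concave L"
    using L(2) by (simp add: strictly_convex_concave_def)
  have V_eq: "V z = (- fst (grad L (h (fst z), k (snd z))), snd (grad L (h (fst z), k (snd z))))" for z
    by (simp add: V_def reduced_field_def split_beta)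
  have hk: "boundedly_lipschitz (\<lambda>z. (h (fst z), k (snd z)))"
    by (intro boundedly_lipschitz_Pair boundedly_lipschitz_compose[OF h(1)] boundedly_lipschitz_compose[OF k(1)]
        boundedly_lipschitz_bounded_linear bounded_linear_fst bounded_linear_snd)
  note G = boundedly_lipschitz_compose[OF C2_imp_boundedly_lipschitz_grad[OF L(1)] hk]
  have V: "boundedly_lipschitz V"
    unfolding V_eq[abs_def]
    by (intro boundedly_lipschitz_Pair boundedly_lipschitz_minus
        boundedly_lipschitz_linear_compose[OF bounded_linear_fst G]
        boundedly_lipschitz_linear_compose[OF bounded_linear_snd G])
  have contV: "continuous_on UNIV V"
    using boundedly_lipschitz_imp_continuous[OF V] .
  have pot: "(Eh has_derivative (\<lambda>v. v \<bullet> (h s - p))) (at s)" "Eh s \<ge> 0" "bounded {s. Eh s \<le> a}"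
    "(Ek has_derivative (\<lambda>v. v \<bullet> (k r - q))) (at r)" "Ek r \<ge> 0" "bounded {r. Ek r \<le> a}" for s r a
    using h(3) k(3) by (auto simp: coercive_potential_def)
  have E: "(E has_derivative E' z) (at z)" for z
    unfolding E_def E'_def
    by (intro has_derivative_add has_derivative_compose[OF _ pot(1)] has_derivative_compose[OF _ pot(4)]
        has_derivative_fst has_derivative_snd has_derivative_ident)
  have decr: "E' z (V z) \<le> L (p, k (snd z)) - L (h (fst z), q)" for z
    using convex_tangent_fst[OF L(1) cc, of "h (fst z)" "k (snd z)" p]
      concave_tangent_snd[OF L(1) cc, of "h (fst z)" q "k (snd z)"]
    by (simp add: E'_def V_eq algebra_simps inner_commute)
  have saddle: "L (p, y) \<le> L (p, q)" "L (p, q) \<le> L (x, q)" for x y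
    using pq by (auto simp: Solution_def)
  have decr0: "E' z (V z) \<le> 0" for z
    using decr[of z] saddle(1)[of "k (snd z)"] saddle(2)[of "h (fst z)"] by linarith
  have "{z. E z \<le> a} \<subseteq> {s. Eh s \<le> a} \<times> {r. Ek r \<le> a}" for a
    using pot(2,5) by (auto simp: E_def) (smt (verit))+
  then have sublevel: "bounded {z. E z \<le> a}" for a
    by (rule bounded_subset[OF bounded_Times[OF pot(3,6)]])
  obtain w where w: "solves_on {0..} V w" "w 0 = w0" "\<And>t. t \<ge> 0 \<Longrightarrow> E (w t) \<le> E w0"
    using solution_exists_of_lyapunov[OF V E decr0 sublevel] by blast
  have bounded_w: "bounded (w ` {0..})"
    by (rule bounded_subset[OF sublevel[of "E w0"]]) (use w(3) in auto)
  have w_deriv: "(w has_vector_derivative V (w t)) (at t within {0..})" if "t \<ge> 0" for t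
    using w(1) that by (simp add: solves_on_def)
  obtain B where B: "B > 0" "\<And>t. t \<ge> 0 \<Longrightarrow> norm (V (w t)) \<le> B"
    using boundedly_lipschitz_bounded_image[OF V bounded_w] unfolding bounded_pos by fastforce
  have lip: "B-lipschitz_on {0..} w"
  proof (rule bounded_derivative_imp_lipschitz)
    show "(w has_derivative (\<lambda>h. h *\<^sub>R V (w t))) (at t within {0..})" if "t \<in> {0..}" for t
      using w_deriv that by (simp add: has_vector_derivative_def)
    show "onorm (\<lambda>h::real. h *\<^sub>R V (w t)) \<le> B" if "t \<in> {0..}" for t
      using B(2)[of t] that by (intro onorm_le) (auto simp: mult.commute[of B] intro: mult_left_mono)
  qed (use B(1) in auto)
  have "\<exists>l. ((\<lambda>t. E (w t)) \<longlongrightarrow> l) at_top"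
  proof -
    define l where "l = Inf ((\<lambda>t. E (w t)) ` {0..})"
    have bdd: "bdd_below ((\<lambda>t. E (w t)) ` {0..})"
      by (rule bdd_belowI[of _ 0]) (auto simp: E_def pot)
    have "((\<lambda>t. E (w t)) \<longlongrightarrow> l) at_top"
    proof (rule order_tendstoI)
      fix a assume "a < l"
      then have "\<forall>t\<ge>0. a < E (w t)"
        using cInf_lower[OF _ bdd] unfolding l_def by fastforce
      then show "\<forall>\<^sub>F t in at_top. a < E (w t)"
        unfolding eventually_at_top_linorder by blast
    next
      fix a assume "l < a"
      then obtain t0 where t0: "t0 \<ge> 0" "E (w t0) < a"
        unfolding l_def using cInf_lessD[of "(\<lambda>t. E (w t)) ` {0..}" a] by auto
      have "E (w t) < a" if "t \<ge> t0" for t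
        using lyapunov_nonincreasing[OF w(1) E decr0 t0(1) that] t0(2) by simp
      then show "\<forall>\<^sub>F t in at_top. E (w t) < a"
        unfolding eventually_at_top_linorder by blast
    qed
    then show ?thesis ..
  qed
  then obtain l where l: "((\<lambda>t. E (w t)) \<longlongrightarrow> l) at_top" by blast
  have dissipation: "L (p, k (snd z)) = L (p, q)" "L (h (fst z), q) = L (p, q)"
    if T: "filterlim T at_top sequentially" "(\<lambda>n. w (T n)) \<longlonglongrightarrow> z" for T z
  proof -
    have "E' z (V z) = 0"
    proof (rule derivative_vanishes_at_limit_points[OF lip _ l _ T, where W = "\<lambda>z. E' z (V z)"])
      fix t :: real assume t: "t \<ge> 0"
      from has_derivative_in_compose2[OF has_derivative_at_withinI[OF E] _ _ w_deriv[OF t, unfolded has_vector_derivative_def], of UNIV]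
      have "((\<lambda>t. E (w t)) has_derivative (\<lambda>h. E' (w t) (h *\<^sub>R V (w t)))) (at t within {0..})"
        using t by simp
      then show "((\<lambda>t. E (w t)) has_vector_derivative E' (w t) (V (w t))) (at t within {0..})"
        unfolding has_vector_derivative_def
        by (simp add: linear_scale[OF has_derivative_linear[OF E]])
    next
      have "continuous_on UNIV (\<lambda>z. E' z (V z))"
        unfolding E'_def
        by (intro continuous_intros contV
            continuous_on_compose2[OF boundedly_lipschitz_imp_continuous[OF h(1), of UNIV]]
            continuous_on_compose2[OF boundedly_lipschitz_imp_continuous[OF k(1), of UNIV]]) auto
      then show "isCont (\<lambda>z. E' z (V z)) z"
        by (simp add: continuous_on_eq_continuous_at del: split_paired_All)
    qed
    then show "L (p, k (snd z)) = L (p, q)" "L (h (fst z), q) = L (p, q)"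
      using decr[of z] saddle(1)[of "k (snd z)"] saddle(2)[of "h (fst z)"] by linarith+
  qed
  \<comment> \<open>a linear component with a single limit converges, so its velocity vanishes at limit points\<close>
  have at_rest: "A (V z) = 0"
    if A: "bounded_linear A" and c: "\<And>T z. filterlim T at_top sequentially \<Longrightarrow> (\<lambda>n. w (T n)) \<longlonglongrightarrow> z \<Longrightarrow> A z = c"
      and T: "filterlim T at_top sequentially" "(\<lambda>n. w (T n)) \<longlonglongrightarrow> z"
    for A :: "'a \<times> 'b \<Rightarrow> 'c::real_normed_vector" and c T z
  proof -
    have contA: "continuous_on S A" for S
      using A by (simp add: linear_continuous_on)
    show ?thesis
    proof (rule derivative_vanishes_at_limit_points[OF lip _ tendsto_of_limit_points[OF bounded_w contA c] _ T, where W = "\<lambda>z. A (V z)"])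
      show "((\<lambda>t. A (w t)) has_vector_derivative A (V (w t))) (at t within {0..})" if "t \<ge> 0" for t
        using bounded_linear.has_vector_derivative[OF A w_deriv[OF that]] .
      show "isCont (\<lambda>z. A (V z)) z"
        using continuous_on_compose2[OF contA[of UNIV] contV]
        by (simp add: continuous_on_eq_continuous_at del: split_paired_All)
    qed
  qed
  have "(h (fst z), k (snd z)) \<in> Solution L"
    if T: "filterlim T at_top sequentially" "(\<lambda>n. w (T n)) \<longlonglongrightarrow> z" for T z
  proof -
    consider "strictly_convex (\<lambda>x. L (x, q))" | "strictly_concave (\<lambda>y. L (p, y))"
      using L(2) unfolding strictly_convex_concave_def by blast
    then show ?thesis
    proof cases
      case 1
      have hp: "h (fst z) = p" if "filterlim T at_top sequentially" "(\<lambda>n. w (T n)) \<longlonglongrightarrow> z" for T z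
        using strictly_convex_minimum_unique[OF 1] saddle(2) dissipation(2)[OF that] by blast
      have "fst z' = fst z" if "filterlim T' at_top sequentially" "(\<lambda>n. w (T' n)) \<longlonglongrightarrow> z'" for T' z'
        using hp[OF that] hp[OF T] h(2) by (metis injD)
      then have "fst (V z) = 0"
        by (rule at_rest[OF bounded_linear_fst _ T])
      then have "L (p, k (snd z)) \<le> L (x, k (snd z))" for x
        using convex_tangent_fst[OF L(1) cc, of p "k (snd z)" x] hp[OF T] by (simp add: V_eq)
      then show ?thesis
        using dissipation(1)[OF T] saddle(1) hp[OF T] by (simp add: Solution_def)
    next
      case 2
      then have sc: "strictly_convex (\<lambda>y. - L (p, y))"
        by (simp add: strictly_concave_def)
      have kq: "k (snd z) = q" if "filterlim T at_top sequentially" "(\<lambda>n. w (T n)) \<longlonglongrightarrow> z" for T z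
        by (rule strictly_convex_minimum_unique[OF sc]) (use saddle(1) dissipation(1)[OF that] in auto)
      have "snd z' = snd z" if "filterlim T' at_top sequentially" "(\<lambda>n. w (T' n)) \<longlonglongrightarrow> z'" for T' z'
        using kq[OF that] kq[OF T] k(2) by (metis injD)
      then have "snd (V z) = 0"
        by (rule at_rest[OF bounded_linear_snd _ T])
      then have "L (h (fst z), y) \<le> L (h (fst z), q)" for y
        using concave_tangent_snd[OF L(1) cc, of "h (fst z)" y q] kq[OF T] by (simp add: V_eq)
      then show ?thesis
        using dissipation(2)[OF T] saddle(2) kq[OF T] by (simp add: Solution_def)
    qed
  qed
  then show thesis
    using that w(1,2) bounded_w unfolding V_def by blast
qed

section \<open>Gradient ascent curves as coordinates\<close>

lemma gradient_ascent_unique: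
  fixes k :: "'a::euclidean_space \<Rightarrow> real"
  assumes "C2 k" "gradient_ascent k x0 x" "gradient_ascent k x0 y"
  shows "x = y"
proof
  fix t
  show "x t = y t"
    using assms solution_unique[OF C2_imp_boundedly_lipschitz_grad[OF assms(1)], of UNIV x y 0 t]
    by (simp add: gradient_ascent_def)
qed

lemma gradient_ascent_image_eq:
  fixes k :: "'a::euclidean_space \<Rightarrow> real"
  assumes "C2 k" "gradient_ascent k x0 x"
  shows "gradient_ascent_image k x0 = range (\<lambda>t. k (x t))"
proof -
  have "(THE x. gradient_ascent k x0 x) = x"
    using assms(2) gradient_ascent_unique[OF assms(1)] by (intro the_equality) auto
  then show ?thesis
    by (simp add: gradient_ascent_image_def o_def)
qed

text \<open>
By uniqueness, a trajectory that meets a stationary point is constant.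
\<close>

lemma gradient_ascent_nonstationary:
  fixes k :: "'a::euclidean_space \<Rightarrow> real"
  assumes k: "C2 k" and x: "gradient_ascent k x0 x" and "grad k x0 \<noteq> 0"
  shows "grad k (x t) \<noteq> 0"
proof
  assume "grad k (x t) = 0"
  then have "solves_on UNIV (grad k) (\<lambda>_. x t)"
    by (simp add: solves_on_def)
  then have "x 0 = x t"
    using x solution_unique[OF C2_imp_boundedly_lipschitz_grad[OF k], of UNIV x "\<lambda>_. x t" t 0]
    by (simp add: gradient_ascent_def)
  then show False
    using \<open>grad k (x t) = 0\<close> x assms(3) by (simp add: gradient_ascent_def)
qed

lemma gradient_ascent_value_derivative:
  fixes k :: "'a::euclidean_space \<Rightarrow> real"
  assumes k: "C2 k" and x: "gradient_ascent k x0 x"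
  shows "((\<lambda>t. k (x t)) has_real_derivative (norm (grad k (x t)))\<^sup>2) (at t)"
proof -
  have "(x has_derivative (\<lambda>h. h *\<^sub>R grad k (x t))) (at t)"
    using x by (simp add: gradient_ascent_def solves_on_def has_vector_derivative_def)
  moreover have "(k has_derivative (\<lambda>v. v \<bullet> grad k (x t))) (at (x t))"
    using C2_imp_GDERIV[OF k] unfolding gderiv_def .
  ultimately have "((\<lambda>t. k (x t)) has_derivative (\<lambda>h. (h *\<^sub>R grad k (x t)) \<bullet> grad k (x t))) (at t)"
    by (rule has_derivative_compose)
  then show ?thesis
    unfolding has_field_derivative_def
    by (rule has_derivative_eq_rhs) (simp add: fun_eq_iff power2_norm_eq_inner mult.commute)
qed

lemma gradient_ascent_value_strict_mono:
  fixes k :: "'a::euclidean_space \<Rightarrow> real"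
  assumes k: "C2 k" and x: "gradient_ascent k x0 x" and "grad k x0 \<noteq> 0"
  shows "strict_mono (\<lambda>t. k (x t))"
proof (rule strict_monoI)
  fix s t :: real assume "s < t"
  then show "k (x s) < k (x t)"
    by (rule DERIV_pos_imp_increasing[where f = "\<lambda>t. k (x t)"])
      (use gradient_ascent_value_derivative[OF k x] gradient_ascent_nonstationary[OF k x assms(3)]
        in \<open>fastforce intro: exI[of _ "(norm _)\<^sup>2"]\<close>)
qed

text \<open>
Translation by \<open>\<theta>' - \<theta>\<close> leaves \<open>h\<close> unchanged, and it carries \<open>\<theta>\<close> to \<open>\<theta>'\<close>.
\<close>

lemma grad_depends_only_on_block:
  fixes h :: "real^'k::finite \<Rightarrow> real"
  assumes h: "C2 h" and dep: "depends_only_on_block b i h"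
    and eq: "\<And>k. b k = i \<Longrightarrow> \<theta> $ k = \<theta>' $ k"
  shows "grad h \<theta> = grad h \<theta>'"
proof -
  have shift: "h (x + (\<theta>' - \<theta>)) = h x" for x
    using dep eq unfolding depends_only_on_block_def by simp
  have "(h has_derivative (\<lambda>v. v \<bullet> grad h \<theta>')) (at (\<theta> + (\<theta>' - \<theta>)))"
    using C2_imp_GDERIV[OF h, of \<theta>'] by (simp add: gderiv_def)
  moreover have "((\<lambda>x. x + (\<theta>' - \<theta>)) has_derivative (\<lambda>v. v)) (at \<theta>)"
    by (auto intro!: derivative_eq_intros)
  ultimately have "((\<lambda>x. h (x + (\<theta>' - \<theta>))) has_derivative (\<lambda>v. v \<bullet> grad h \<theta>')) (at \<theta>)"
    using has_derivative_compose by blast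
  then have "(h has_derivative (\<lambda>v. v \<bullet> grad h \<theta>')) (at \<theta>)"
    by (simp add: shift)
  then have "(\<lambda>v. v \<bullet> grad h \<theta>') = (\<lambda>v. v \<bullet> grad h \<theta>)"
    using C2_imp_GDERIV[OF h, of \<theta>] has_derivative_unique unfolding gderiv_def by blast
  then show ?thesis
    by (metis vector_eq_ldot)
qed

text \<open>
The map \<open>X\<close> follows all the gradient ascent curves of the blocks, each with its own time: coordinate
\<open>k\<close> of \<open>X s\<close> belongs to block \<open>b k\<close> and is read off from the curve of \<open>f (b k)\<close> at the time
\<open>s $ b k\<close>.  By the block structure neither the value nor the gradient of \<open>f i\<close> sees that the
other blocks are at other times.  The last property is the chain rule in the form in which it turns
a solution of the reduced system into one of gradient descent ascent.
\<close>

lemma block_reparametrization: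
  fixes b :: "'k::finite \<Rightarrow> 'n::finite" and f :: "'n \<Rightarrow> real^'k \<Rightarrow> real"
  assumes dep: "\<And>i. depends_only_on_block b i (f i)" and C2: "\<And>i. C2 (f i)"
    and complete: "\<And>i. complete_gradient_ascent (f i)"
    and nonstat: "\<And>i. grad (f i) \<theta>0 \<noteq> 0" and p: "\<And>i. p $ i \<in> gradient_ascent_image (f i) \<theta>0"
  obtains X h E where "X 0 = \<theta>0" "continuous_on UNIV X" "\<And>s. tuple_map f (X s) = h s"
    "boundedly_lipschitz h" "inj h" "p \<in> range h" "coercive_potential h p E"
    "\<And>s v t T. (s has_vector_derivative v) (at t within T) \<Longrightarrow>
      ((\<lambda>t. X (s t)) has_vector_derivative (\<chi> k. grad (f (b k)) (X (s t)) $ k * v $ b k)) (at t within T)"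
proof -
  have "\<forall>i. \<exists>x. gradient_ascent (f i) \<theta>0 x"
    using complete by (simp add: complete_gradient_ascent_def)
  from choice[OF this] obtain x where x: "\<And>i. gradient_ascent (f i) \<theta>0 (x i)"
    by blast
  have x_deriv: "(x i has_vector_derivative grad (f i) (x i t)) (at t)" for i t
    using x[of i] by (simp add: gradient_ascent_def solves_on_def)
  define \<phi> where "\<phi> i t = f i (x i t)" for i t
  define X where "X s = (\<chi> k. x (b k) (s $ b k) $ k)" for s :: "real^'n"
  define h where "h s = (\<chi> i. \<phi> i (s $ i))" for s :: "real^'n"
  have cont_x: "continuous_on UNIV (x i)" for i
    using x_deriv by (meson continuous_at_imp_continuous_on has_vector_derivative_continuous)
  have cont_grad: "continuous_on UNIV (\<lambda>t. grad (f i) (x i t))" for i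
    by (rule continuous_on_compose2[OF boundedly_lipschitz_imp_continuous[OF C2_imp_boundedly_lipschitz_grad[OF C2]] cont_x]) auto
  have \<phi>_deriv: "(\<phi> i has_real_derivative (norm (grad (f i) (x i t)))\<^sup>2) (at t)" for i t
    unfolding \<phi>_def by (rule gradient_ascent_value_derivative[OF C2 x])
  have \<phi>_lip: "boundedly_lipschitz (\<phi> i)" for i
    by (rule boundedly_lipschitz_of_vector_derivative[OF \<phi>_deriv[unfolded has_real_derivative_iff_has_vector_derivative]])
      (intro continuous_intros cont_grad)
  have \<phi>_mono: "strict_mono (\<phi> i)" for i
    unfolding \<phi>_def by (rule gradient_ascent_value_strict_mono[OF C2 x nonstat])
  have \<phi>_range: "p $ i \<in> range (\<phi> i)" for i
    using p[of i] gradient_ascent_image_eq[OF C2 x, of i] by (simp add: \<phi>_def)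
  obtain E where E: "coercive_potential h p E"
    using separable_coercive_potential[OF \<phi>_mono boundedly_lipschitz_imp_continuous[OF \<phi>_lip] \<phi>_range]
    unfolding h_def by blast
  have X0: "X 0 = \<theta>0"
    using x by (simp add: X_def gradient_ascent_def vec_eq_iff)
  have cont_X: "continuous_on UNIV X"
    unfolding X_def
    by (intro continuous_on_vec_lambda continuous_intros continuous_on_compose2[OF cont_x]) auto
  have "f i (X s) = f i (x i (s $ i))" for i s
    using dep[of i] unfolding depends_only_on_block_def X_def by simp
  then have fX: "tuple_map f (X s) = h s" for s
    by (simp add: tuple_map_def h_def \<phi>_def)
  have gradX: "grad (f i) (X s) = grad (f i) (x i (s $ i))" for i s
    by (rule grad_depends_only_on_block[OF C2 dep]) (simp add: X_def)
  have h_lip: "boundedly_lipschitz h"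
    unfolding h_def
    by (intro boundedly_lipschitz_vec_lambda boundedly_lipschitz_compose[OF \<phi>_lip]
        boundedly_lipschitz_bounded_linear bounded_linear_vec_nth)
  have h_inj: "inj h"
    using strict_mono_eq[OF \<phi>_mono] by (simp add: inj_def h_def vec_eq_iff)
  have "\<forall>i. \<exists>r. p $ i = \<phi> i r"
    using \<phi>_range by blast
  from choice[OF this] obtain \<sigma> where "\<And>i. p $ i = \<phi> i (\<sigma> i)"
    by blast
  then have "p = h (\<chi> i. \<sigma> i)"
    by (simp add: h_def vec_eq_iff)
  then have p_range: "p \<in> range h" by blast
  have "((\<lambda>t. X (s t)) has_vector_derivative (\<chi> k. grad (f (b k)) (X (s t)) $ k * v $ b k)) (at t within T)"
    if s: "(s has_vector_derivative v) (at t within T)" for s v t T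
  proof -
    have "((\<lambda>t. x (b k) (s t $ b k) $ k) has_real_derivative grad (f (b k)) (X (s t)) $ k * v $ b k) (at t within T)" for k
    proof -
      have "((\<lambda>t. s t $ b k) has_vector_derivative v $ b k) (at t within T)"
        by (rule bounded_linear.has_vector_derivative[OF bounded_linear_vec_nth s])
      moreover have "((\<lambda>r. x (b k) r $ k) has_vector_derivative grad (f (b k)) (X (s t)) $ k) (at (s t $ b k))"
        unfolding gradX by (rule bounded_linear.has_vector_derivative[OF bounded_linear_vec_nth x_deriv])
      ultimately show ?thesis
        unfolding has_real_derivative_iff_has_vector_derivative[symmetric]
        by (intro DERIV_chain2)
    qed
    then have "((\<lambda>t. \<Sum>k\<in>UNIV. x (b k) (s t $ b k) $ k *\<^sub>R axis k (1::real)) has_vector_derivative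
        (\<Sum>k\<in>UNIV. (grad (f (b k)) (X (s t)) $ k * v $ b k) *\<^sub>R axis k 1)) (at t within T)"
      by (intro has_vector_derivative_sum bounded_linear.has_vector_derivative[OF bounded_linear_scaleR_left])
        (simp add: has_real_derivative_iff_has_vector_derivative)
    then show ?thesis
      by (simp add: X_def vec_lambda_eq_sum_axis)
  qed
  then show thesis
    using that[OF X0 cont_X fX h_lip h_inj p_range E] by blast
qed

section \<open>Gradient descent ascent\<close>

lemma tuple_map_boundedly_lipschitz:
  assumes "\<And>i. C2 (f i)"
  shows "boundedly_lipschitz (tuple_map f :: real^'k::finite \<Rightarrow> real^'n::finite)"
proof -
  have "boundedly_lipschitz (f i)" for i
  proof -
    obtain f' :: "real^'k \<Rightarrow> (real^'k) \<Rightarrow>\<^sub>L real" and f'' :: "real^'k \<Rightarrow> (real^'k) \<Rightarrow>\<^sub>L (real^'k) \<Rightarrow>\<^sub>L real"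
      where "\<And>x. (f i has_derivative blinfun_apply (f' x)) (at x)"
        "\<And>x. (f' has_derivative blinfun_apply (f'' x)) (at x)"
      using assms[of i] unfolding C2_def by blast
    then show ?thesis
      by (intro boundedly_lipschitz_of_blinfun_derivative)
        (auto intro!: continuous_at_imp_continuous_on has_derivative_continuous)
  qed
  then show ?thesis
    unfolding tuple_map_def[abs_def] by (rule boundedly_lipschitz_vec_lambda)
qed

lemma partials_eq_grad:
  fixes L :: "(real^'n::finite) \<times> (real^'m::finite) \<Rightarrow> real"
  assumes "C2 L"
  shows partial_x_eq: "partial_x L i x y = fst (grad L (x, y)) $ i"
    and partial_y_eq: "partial_y L j x y = snd (grad L (x, y)) $ j"
proof -
  have line: "((\<lambda>t. a + t *\<^sub>R v) has_derivative (\<lambda>h. h *\<^sub>R v)) (at (0::real))" for a v :: "'z::real_normed_vector"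
    by (auto intro!: derivative_eq_intros)
  have "((\<lambda>t. L (x + t *\<^sub>R axis i 1, y)) has_real_derivative fst (grad L (x, y)) $ i) (at 0)"
    using has_derivative_compose[OF line, of "\<lambda>x. L (x, y)" _ x "axis i 1"] C2_derivative_fst[OF assms, of y x]
    by (fastforce simp: has_field_derivative_def inner_axis' mult.commute elim!: has_derivative_eq_rhs)
  then show "partial_x L i x y = fst (grad L (x, y)) $ i"
    unfolding partial_x_def by (rule DERIV_imp_deriv)
  have "((\<lambda>t. L (x, y + t *\<^sub>R axis j 1)) has_real_derivative snd (grad L (x, y)) $ j) (at 0)"
    using has_derivative_compose[OF line, of "\<lambda>y. L (x, y)" _ y "axis j 1"] C2_derivative_snd[OF assms, of x y]
    by (fastforce simp: has_field_derivative_def inner_axis' mult.commute elim!: has_derivative_eq_rhs)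
  then show "partial_y L j x y = snd (grad L (x, y)) $ j"
    unfolding partial_y_def by (rule DERIV_imp_deriv)
qed

text \<open>
The shape of the field in which the velocity of the times appears as the second factor, as in the
chain rule of \<open>block_reparametrization\<close>.
\<close>

lemma gda_field_eq:
  assumes "C2 L"
  shows "gda_field b c f g L z =
    (\<chi> k. grad (f (b k)) (fst z) $ k * (- fst (grad L (tuple_map f (fst z), tuple_map g (snd z)))) $ b k,
     \<chi> l. grad (g (c l)) (snd z) $ l * snd (grad L (tuple_map f (fst z), tuple_map g (snd z))) $ c l)"
  by (simp add: gda_field_def split_beta partials_eq_grad[OF assms])

lemma gda_field_boundedly_lipschitz:
  fixes b :: "'k::finite \<Rightarrow> 'n::finite" and c :: "'l::finite \<Rightarrow> 'm::finite"
  assumes f: "\<And>i. C2 (f i)" and g: "\<And>j. C2 (g j)" and L: "C2 L"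
  shows "boundedly_lipschitz (gda_field b c f g L)"
proof -
  note fst_lip = boundedly_lipschitz_bounded_linear[OF bounded_linear_fst]
    and snd_lip = boundedly_lipschitz_bounded_linear[OF bounded_linear_snd]
  have "boundedly_lipschitz (\<lambda>z. (tuple_map f (fst z), tuple_map g (snd z)))"
    by (intro boundedly_lipschitz_Pair
        boundedly_lipschitz_compose[OF tuple_map_boundedly_lipschitz[OF f] fst_lip]
        boundedly_lipschitz_compose[OF tuple_map_boundedly_lipschitz[OF g] snd_lip])
  note G = boundedly_lipschitz_compose[OF C2_imp_boundedly_lipschitz_grad[OF L] this]
  show ?thesis
    unfolding gda_field_eq[OF L, abs_def]
    by (intro boundedly_lipschitz_Pair boundedly_lipschitz_mult_vec_lambda
        boundedly_lipschitz_linear_compose[OF bounded_linear_vec_nth] boundedly_lipschitz_minus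
        boundedly_lipschitz_linear_compose[OF bounded_linear_fst G]
        boundedly_lipschitz_linear_compose[OF bounded_linear_snd G]
        boundedly_lipschitz_compose[OF C2_imp_boundedly_lipschitz_grad[OF f] fst_lip]
        boundedly_lipschitz_compose[OF C2_imp_boundedly_lipschitz_grad[OF g] snd_lip])
qed

theorem corollary1:
  fixes b :: "'k::finite \<Rightarrow> 'n::finite"
    and c :: "'l::finite \<Rightarrow> 'm::finite"
    and f :: "'n \<Rightarrow> real^'k \<Rightarrow> real"
    and g :: "'m \<Rightarrow> real^'l \<Rightarrow> real"
    and L :: "(real^'n) \<times> (real^'m) \<Rightarrow> real"
  assumes "surj b" and "surj c"
    and "\<And>i. depends_only_on_block b i (f i)"
    and "\<And>j. depends_only_on_block c j (g j)"
    and "\<And>i. C2 (f i)" and "\<And>j. C2 (g j)" and "C2 L"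
    and "\<And>i. complete_gradient_ascent (f i)"
    and "\<And>j. complete_gradient_ascent (g j)"
    and "strictly_convex_concave L"
    and "\<And>\<theta> \<phi>. \<exists>(p, q) \<in> Solution L. safe f g \<theta> \<phi> p q"
  shows "globally_asymptotically_stable (gda_field b c f g L)
           {(\<theta>, \<phi>). (tuple_map f \<theta>, tuple_map g \<phi>) \<in> Solution L}"
proof -
  let ?V = "gda_field b c f g L"
  let ?S = "{(\<theta>, \<phi>). (tuple_map f \<theta>, tuple_map g \<phi>) \<in> Solution L}"
  have V: "boundedly_lipschitz ?V"
    by (intro gda_field_boundedly_lipschitz assms)
  have "\<exists>w. solves_on {0..} ?V w \<and> w 0 = w0 \<and> approaches w ?S" for w0
  proof -
    obtain \<theta>0 \<phi>0 where w0: "w0 = (\<theta>0, \<phi>0)" by fastforce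
    obtain p q where pq: "(p, q) \<in> Solution L" and safe: "safe f g \<theta>0 \<phi>0 p q"
      using assms(11)[of \<theta>0 \<phi>0] by blast
    have safe_\<theta>: "grad (f i) \<theta>0 \<noteq> 0" "p $ i \<in> gradient_ascent_image (f i) \<theta>0"
      and safe_\<phi>: "grad (g j) \<phi>0 \<noteq> 0" "q $ j \<in> gradient_ascent_image (g j) \<phi>0" for i j
      using safe by (simp_all add: safe_def)
    obtain X h E where X: "X 0 = \<theta>0" "continuous_on UNIV X" "\<And>s. tuple_map f (X s) = h s"
      and h: "boundedly_lipschitz h" "inj h" "p \<in> range h" "coercive_potential h p E"
      and dX: "\<And>s v t T. (s has_vector_derivative v) (at t within T) \<Longrightarrow>
        ((\<lambda>t. X (s t)) has_vector_derivative (\<chi> k. grad (f (b k)) (X (s t)) $ k * v $ b k)) (at t within T)"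
      by (fact block_reparametrization[OF assms(3) assms(5) assms(8) safe_\<theta>])
    obtain Y k E' where Y: "Y 0 = \<phi>0" "continuous_on UNIV Y" "\<And>s. tuple_map g (Y s) = k s"
      and k: "boundedly_lipschitz k" "inj k" "q \<in> range k" "coercive_potential k q E'"
      and dY: "\<And>s v t T. (s has_vector_derivative v) (at t within T) \<Longrightarrow>
        ((\<lambda>t. Y (s t)) has_vector_derivative (\<chi> l. grad (g (c l)) (Y (s t)) $ l * v $ c l)) (at t within T)"
      by (fact block_reparametrization[OF assms(4) assms(6) assms(9) safe_\<phi>])
    obtain u where u: "solves_on {0..} (reduced_field L h k) u" "u 0 = 0" "bounded (u ` {0..})"
      and u_lim: "\<And>T z. filterlim T at_top sequentially \<Longrightarrow> (\<lambda>n. u (T n)) \<longlonglongrightarrow> z \<Longrightarrow>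
        (h (fst z), k (snd z)) \<in> Solution L"
      by (fact reduced_field_converges[OF assms(7) assms(10) pq h(1,2,4) k(1,2,4)])
    define w where "w t = (X (fst (u t)), Y (snd (u t)))" for t
    have "solves_on {0..} ?V w"
      unfolding solves_on_def
    proof
      fix t :: real assume "t \<in> {0..}"
      then have "(u has_vector_derivative reduced_field L h k (u t)) (at t within {0..})"
        using u(1) by (simp add: solves_on_def)
      note du = bounded_linear.has_vector_derivative[OF bounded_linear_fst this]
        bounded_linear.has_vector_derivative[OF bounded_linear_snd this]
      show "(w has_vector_derivative ?V (w t)) (at t within {0..})"
        using has_vector_derivative_Pair[OF dX[OF du(1)] dY[OF du(2)]]
        by (simp add: w_def[abs_def] gda_field_eq[OF assms(7)] reduced_field_def split_beta X(3) Y(3))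
    qed
    moreover have "w 0 = w0"
      by (simp add: w_def u(2) X(1) Y(1) w0)
    moreover have "approaches w ?S"
      unfolding approaches_def
    proof
      obtain s r where "h s = p" "k r = q"
        using h(3) k(3) by blast
      then have "(X s, Y r) \<in> ?S"
        using pq by (simp add: X(3) Y(3))
      then show "?S \<noteq> {}" by blast
      show "((\<lambda>t. infdist (w t) ?S) \<longlongrightarrow> 0) at_top"
        unfolding w_def
      proof (rule tendsto_of_limit_points[OF u(3), where A = "\<lambda>z. infdist (X (fst z), Y (snd z)) ?S"])
        show "continuous_on UNIV (\<lambda>z. infdist (X (fst z), Y (snd z)) ?S)"
          by (intro continuous_intros continuous_on_compose2[OF X(2)] continuous_on_compose2[OF Y(2)]) auto
      next
        fix T z assume "filterlim T at_top sequentially" "(\<lambda>n. u (T n)) \<longlonglongrightarrow> z"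
        then have "(X (fst z), Y (snd z)) \<in> ?S"
          using u_lim by (simp add: X(3) Y(3))
        then show "infdist (X (fst z), Y (snd z)) ?S = 0"
          by simp
      qed
    qed
    ultimately show ?thesis by blast
  qed
  note existence = this
  show ?thesis
    unfolding globally_asymptotically_stable_def
  proof (intro allI conjI impI)
    fix w0
    show "\<exists>w. solves_on {0..} ?V w \<and> w 0 = w0"
      using existence by blast
    fix w assume w: "solves_on {0..} ?V w \<and> w 0 = w0"
    obtain v where v: "solves_on {0..} ?V v" "v 0 = w0" "approaches v ?S"
      using existence by blast
    have eq: "w t = v t" if "t \<ge> 0" for t
      using solution_unique[OF V, of "{0..}" w v 0 t] w v that by (simp add: is_interval_ci)
    have "\<forall>\<^sub>F t in at_top. infdist (v t) ?S = infdist (w t) ?S"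
      using eventually_ge_at_top[of 0] by eventually_elim (simp add: eq)
    then show "approaches w ?S"
      using v(3) unfolding approaches_def by (auto elim: Lim_transform_eventually)
  qed
qed

end
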